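(* Let $U:\mathbb{R}^d\to\mathbb{R}$ be twice continuously differentiable and suppose that: (A.1) $U$ has a global minimum at $0$ with $U(0)=0$; (A.2) there exists $L>0$ such that $|\nabla U(x)-\nabla U(y)|\le L|x-y|$ for all $x,y\in\mathbb{R}^d$; (A.3) there exists $L_H\ge 0$ such that $\|\nabla^2U(x)-\nabla^2U(y)\|_{\mathsf{op}}\le L_H|x-y|$ for all $x,y\in\mathbb{R}^d$. Let $T>0$ satisfy $LT^2\le 1/4$ and let $h>0$ satisfy $T/h\in\mathbb{Z}$. Let $(q_t(x,v),v_t(x,v))$ denote the exact Hamiltonian flow and $(\tilde Q_{t_k}(x,v),\tilde V_{t_k}(x,v))$ the rRKN 2.5 chain with step size $h$ (both defined in the context), with $t_k=kh$. Then for any $x,v\in\mathbb{R}^d$, $$\max_{t_k\le T}\left(E\left[\left\|(\tilde Q_{t_k}(x,v),\tilde V_{t_k}(x,v))-(q_{t_k}(x,v),v_{t_k}(x,v))\right\|_{\mathsf{w}}^2\right]\right)^{1/2}\le \frac{11}{10}e^{5/2}\,\|(x,v)\|_{\mathsf{w}}\,(L^{1/2}h)^{5/2}+9e^{5/2}\,\|(x,v)\|_{\mathsf{w}}^2\,L^{1/2}\,\frac{L_Hh^3}{L^{1/4}h^{1/2}}.$$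
   Context: $|\cdot|$ is the Euclidean norm, $\|\cdot\|_{\mathsf{op}}$ the operator norm, and $\mathbf{F}=-\nabla U$. The weighted norm on $\mathbb{R}^{2d}$ is $\|(x,v)\|_{\mathsf{w}}^2=|x|^2+L^{-1}|v|^2$. Exact flow: $(q_t,v_t)=(q_t(x,v),v_t(x,v))$ is the solution of $\frac{d}{dt}q_t=v_t$, $\frac{d}{dt}v_t=\mathbf{F}(q_t)$, $(q_0,v_0)=(x,v)$. rRKN 2.5 (5/2-order randomized Runge-Kutta-Nyström) chain: let $(\mathcal{U}_i)_{i\in\mathbb{N}_0}$ be i.i.d. random variables with the $\text{Triangular}(0,1)$ distribution, i.e. with density $f(\mathsf{x})=2\mathsf{x}$ on $[0,1]$. With $t_i=ih$, $(\tilde Q_0,\tilde V_0)=(x,v)$ and, for $i\in\mathbb{N}_0$, $$\tilde Q_{t_{i+1}}=\tilde Q_{t_i}+h\tilde V_{t_i}+\frac{h^2}{2}\tilde{\mathbf F}^-_{t_i}+\frac{h^2}{6\,\mathcal{U}_i}\left(\tilde{\mathbf F}^+_{t_i}-\tilde{\mathbf F}^-_{t_i}\right),\qquad \tilde V_{t_{i+1}}=\tilde V_{t_i}+h\tilde{\mathbf F}^-_{t_i}+\frac{h}{2\,\mathcal{U}_i}\left(\tilde{\mathbf F}^+_{t_i}-\tilde{\mathbf F}^-_{t_i}\right),$$ where $\tilde{\mathbf F}^-_{t_i}=\mathbf{F}(\tilde Q_{t_i})$ and $\tilde{\mathbf F}^+_{t_i}=\mathbf{F}\left(\tilde Q_{t_i}+(\mathcal{U}_ih)\tilde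 V_{t_i}+\tfrac12(\mathcal{U}_ih)^2\tilde{\mathbf F}^-_{t_i}\right)$. (Almost surely all $\mathcal{U}_i>0$.) *)

theory Defs
  imports "HOL-Probability.Probability"
begin

definition gradient :: "('a::real_inner \<Rightarrow> real) \<Rightarrow> 'a \<Rightarrow> 'a" where
  "gradient f x = (THE g. GDERIV f x :> g)"

lemma gradient_eqI:
  assumes "GDERIV f x :> g"
  shows "gradient f x = g"
  unfolding gradient_def
proof (rule the_equality)
  show "GDERIV f x :> g" by fact
next
  fix g' assume "GDERIV f x :> g'"
  then have "(\<lambda>z. inner z g') = (\<lambda>z. inner z g)"
    using assms unfolding gderiv_def by (rule has_derivative_unique)
  then have "inner (g' - g) g' = inner (g' - g) g"
    by (rule fun_cong)
  then have "inner (g' - g) (g' - g) = 0"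
    by (simp add: inner_diff_right)
  then show "g' = g" by simp
qed

definition force :: "('a::real_inner \<Rightarrow> real) \<Rightarrow> 'a \<Rightarrow> 'a" where
  "force f x = - gradient f x"

definition hessian :: "(real ^ 'd \<Rightarrow> real) \<Rightarrow> real ^ 'd \<Rightarrow> real ^ 'd ^ 'd" where
  "hessian f x = jacobian (gradient f) (at x)"

text \<open>Differentiability is required explicitly because \<^const>\<open>gradient\<close> and
  \<^const>\<open>hessian\<close> are total functions.\<close>

definition twice_cont_diff :: "(real ^ 'd \<Rightarrow> real) \<Rightarrow> bool" where
  "twice_cont_diff f \<longleftrightarrow>
     (\<forall>x. f differentiable at x) \<and>
     (\<forall>x. gradient f differentiable at x) \<and>
     continuous_on UNIV (hessian f)"

definition op_norm :: "real ^ 'd ^ 'd \<Rightarrow> real" where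
  "op_norm A = onorm (\<lambda>z. A *v z)"

definition wnorm :: "real \<Rightarrow> (real ^ 'd) \<times> (real ^ 'd) \<Rightarrow> real" where
  "wnorm L z = sqrt ((norm (fst z))\<^sup>2 + (norm (snd z))\<^sup>2 / L)"

text \<open>The trajectory \<open>t \<mapsto> (q t, p t)\<close>, \<open>t \<ge> 0\<close>, of the exact flow started at \<open>(x, v)\<close>;
  the derivative at time 0 is one-sided.\<close>

definition exact_flow_from ::
  "(real ^ 'd \<Rightarrow> real ^ 'd) \<Rightarrow> real ^ 'd \<Rightarrow> real ^ 'd \<Rightarrow>
   (real \<Rightarrow> real ^ 'd) \<Rightarrow> (real \<Rightarrow> real ^ 'd) \<Rightarrow> bool" where
  "exact_flow_from F x v q p \<longleftrightarrow>
     q 0 = x \<and> p 0 = v \<and>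
     (\<forall>t\<ge>0. (q has_vector_derivative p t) (at t within {0..})) \<and>
     (\<forall>t\<ge>0. (p has_vector_derivative F (q t)) (at t within {0..}))"

text \<open>For \<open>u = 0\<close> the divisions below return 0; this is a null event for the random
  variables considered.\<close>

definition rrkn_step ::
  "(real ^ 'd \<Rightarrow> real ^ 'd) \<Rightarrow> real \<Rightarrow> real \<Rightarrow>
   (real ^ 'd) \<times> (real ^ 'd) \<Rightarrow> (real ^ 'd) \<times> (real ^ 'd)" where
  "rrkn_step F h u = (\<lambda>(Q, V).
     let Fminus = F Q;
         Fplus = F (Q + (u * h) *\<^sub>R V + ((u * h)\<^sup>2 / 2) *\<^sub>R Fminus)
     in (Q + h *\<^sub>R V + (h\<^sup>2 / 2) *\<^sub>R Fminus + (h\<^sup>2 / (6 * u)) *\<^sub>R (Fplus - Fminus),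
         V + h *\<^sub>R Fminus + (h / (2 * u)) *\<^sub>R (Fplus - Fminus)))"

text \<open>\<open>rrkn_chain F h u z k\<close> is the state at time \<open>k * h\<close> for the realization \<open>u\<close> of the
  random variables.\<close>

primrec rrkn_chain ::
  "(real ^ 'd \<Rightarrow> real ^ 'd) \<Rightarrow> real \<Rightarrow> (nat \<Rightarrow> real) \<Rightarrow>
   (real ^ 'd) \<times> (real ^ 'd) \<Rightarrow> nat \<Rightarrow> (real ^ 'd) \<times> (real ^ 'd)" where
  "rrkn_chain F h u z 0 = z"
| "rrkn_chain F h u z (Suc i) = rrkn_step F h (u i) (rrkn_chain F h u z i)"

definition triangular_density :: "real \<Rightarrow> ennreal" where
  "triangular_density s = ennreal (2 * s) * indicator {0..1} s"

definition iid_triangular :: "'w measure \<Rightarrow> (nat \<Rightarrow> 'w \<Rightarrow> real) \<Rightarrow> bool" where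
  "iid_triangular M X \<longleftrightarrow>
     prob_space.indep_vars M (\<lambda>_. borel) X UNIV \<and>
     (\<forall>i. distributed M lborel (X i) triangular_density)"

end

theory Submission
  imports Defs
begin

text \<open>After rescaling time and velocity one may take \<open>L = 1\<close>, so that the weighted norm is the
  Euclidean norm on pairs and the total time is at most \<open>1 / 2\<close>. Let \<open>m\<close> be the expectation of one
  step \<open>\<psi>\<close> over its random node. Along the exact solution \<open>\<zeta>\<close>, the error splits as
  \<open>(\<psi> z\<^sub>k - m z\<^sub>k) + (m z\<^sub>k - m \<zeta>\<^sub>k) + (m \<zeta>\<^sub>k - \<zeta>\<^bsub>k+1\<^esub>)\<close>.
  The first part has conditional mean zero and size \<open>\<sigma> = O(h\<^sup>3)\<close>, because the chain is almost surely bounded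
  by \<open>3 |z\<^sub>0|\<close>; the second is controlled by the Lipschitz constant \<open>1 + 5 h / 2\<close> of \<open>m\<close>; the
  third is deterministic, of size \<open>\<beta> = O(h\<^sup>4)\<close>. Hence the root mean squares satisfy
  \<open>a\<^bsub>k+1\<^esub>\<^sup>2 \<le> ((1 + 5 h / 2) a\<^sub>k + \<beta>)\<^sup>2 + \<sigma>\<^sup>2\<close>, so that the fluctuations accumulate only like
  \<open>\<sigma> \<surd>k\<close>, which is of order \<open>h\<close> to the power \<open>5/2\<close>.\<close>

section \<open>Lipschitz forces and the mean of one step\<close>

text \<open>From \<open>2 * a * b\<close> \<le> \<open>a\<^sup>2 + b\<^sup>2\<close>. The step
  estimates below are linear in the two component norms; this turns them into bounds by the norm of
  the pair, and its factor \<open>sqrt 2\<close> enters the rates \<open>2\<close> and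
  \<open>5 / 2\<close>.\<close>

lemma norm_fst_add_norm_snd_le: "norm (fst z) + norm (snd z) \<le> sqrt 2 * norm z"
proof -
  have "(norm (fst z) + norm (snd z))\<^sup>2 \<le> 2 * ((norm (fst z))\<^sup>2 + (norm (snd z))\<^sup>2)"
    using sum_squares_bound[of "norm (fst z)" "norm (snd z)"] by (simp add: power2_sum)
  also have "\<dots> = (sqrt 2 * norm z)\<^sup>2"
    by (simp add: norm_prod_def power_mult_distrib)
  finally show ?thesis
    by (rule power2_le_imp_le) simp
qed

lemma sqrt_2_le: "sqrt 2 \<le> 1.42"
  by (rule real_le_lsqrt) (auto simp: power2_eq_square)

text \<open>The difference quotients in direction \<open>w\<close> are at most
  \<open>C * norm w\<close>, and this passes to the limit. It bounds \<open>DF\<close> by the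
  Lipschitz constant of \<open>F\<close>.\<close>

lemma norm_lipschitz_derivative_le:
  fixes f :: "'a::real_normed_vector \<Rightarrow> 'b::real_normed_vector"
  assumes d: "(f has_derivative f') (at x)"
    and lip: "\<And>y. norm (f y - f x) \<le> C * norm (y - x)"
  shows "norm (f' w) \<le> C * norm w"
proof -
  interpret f': bounded_linear f' using d by (rule has_derivative_bounded_linear)
  have "((\<lambda>t. x + t *\<^sub>R w) has_derivative (\<lambda>t. t *\<^sub>R w)) (at 0)"
    by (auto intro!: derivative_eq_intros)
  moreover have "(f has_derivative f') (at (x + 0 *\<^sub>R w))" using d by simp
  ultimately have "((f \<circ> (\<lambda>t. x + t *\<^sub>R w)) has_derivative (f' \<circ> (\<lambda>t. t *\<^sub>R w))) (at (0::real))"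
    by (rule diff_chain_at)
  then have lim: "(\<lambda>t. norm (f (x + t *\<^sub>R w) - f x - t *\<^sub>R f' w) / norm t) \<midarrow>0\<rightarrow> 0"
    by (simp add: has_derivative_at o_def f'.scaleR)
  have "norm (f' w) - C * norm w \<le> 0"
  proof (rule tendsto_lowerbound[OF lim])
    show "\<forall>\<^sub>F t in at (0::real). norm (f' w) - C * norm w
        \<le> norm (f (x + t *\<^sub>R w) - f x - t *\<^sub>R f' w) / norm t"
      unfolding eventually_at_filter
    proof (intro always_eventually allI impI)
      fix t :: real assume t: "t \<noteq> 0"
      have "norm (t *\<^sub>R f' w) \<le> norm (f (x + t *\<^sub>R w) - f x) + norm (f (x + t *\<^sub>R w) - f x - t *\<^sub>R f' w)"
        using norm_triangle_ineq4[of "f (x + t *\<^sub>R w) - f x" "f (x + t *\<^sub>R w) - f x - t *\<^sub>R f' w"] by simp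
      also have "norm (f (x + t *\<^sub>R w) - f x) \<le> C * (\<bar>t\<bar> * norm w)"
        using lip[of "x + t *\<^sub>R w"] by simp
      finally show "norm (f' w) - C * norm w \<le> norm (f (x + t *\<^sub>R w) - f x - t *\<^sub>R f' w) / norm t"
        using t by (simp add: field_simps)
    qed
  qed simp
  then show ?thesis by simp
qed

text \<open>The normalized setting: Lipschitz constant one for the force, \<open>\<Lambda>\<close>
  for its derivative. The step is at most \<open>1 / 2\<close> because the whole rescaled time
  interval is.\<close>

locale lipschitz_force =
  fixes F :: "real ^ 'd \<Rightarrow> real ^ 'd" and DF :: "real ^ 'd \<Rightarrow> real ^ 'd \<Rightarrow> real ^ 'd"
    and \<Lambda> h :: real
  assumes F_0: "F 0 = 0"
    and F_lip: "norm (F y - F z) \<le> norm (y - z)"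
    and F_deriv: "(F has_derivative DF y) (at y)"
    and DF_lip: "norm (DF y w - DF z w) \<le> \<Lambda> * norm (y - z) * norm w"
    and \<Lambda>_nonneg: "\<Lambda> \<ge> 0"
    and h_pos: "h > 0" and h_le: "h \<le> 1 / 2"
begin

section \<open>Size and Taylor expansion of the force\<close>

lemma F_norm_le: "norm (F y) \<le> norm y"
  using F_lip[of y 0] F_0 by simp

lemma continuous_on_F: "continuous_on S F"
  using F_deriv by (metis continuous_at_imp_continuous_on has_derivative_continuous)

lemma continuous_on_F_compose [continuous_intros]:
  "continuous_on S f \<Longrightarrow> continuous_on S (\<lambda>x. F (f x))"
  by (rule continuous_on_compose2[OF continuous_on_F[of UNIV]]) auto

lemma F_measurable [measurable]: "F \<in> borel_measurable borel"
  by (intro borel_measurable_continuous_onI continuous_on_F)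

lemma DF_norm_le: "norm (DF y w) \<le> norm w"
  using norm_lipschitz_derivative_le[OF F_deriv, of y 1 w] F_lip by simp

lemma bounded_linear_DF: "bounded_linear (DF y)"
  using F_deriv by (rule has_derivative_bounded_linear)

text \<open>On the ball of radius \<open>norm w\<close> around \<open>y\<close> the derivative
  varies by at most \<open>\<Lambda> * norm w\<close>. The mean value inequality then gives the
  constant \<open>\<Lambda>\<close> instead of the sharp \<open>\<Lambda> / 2\<close>, which the
  final bound can afford.\<close>

lemma F_taylor: "norm (F (y + w) - F y - DF y w) \<le> \<Lambda> * (norm w)\<^sup>2"
proof -
  have "norm (F (y + w) - F y - DF y (y + w - y)) \<le> norm (y + w - y) * (\<Lambda> * norm w)"
  proof (rule differentiable_bound_linearization[where f' = DF and S = "cball y (norm w)"])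
    show "y + t *\<^sub>R (y + w - y) \<in> cball y (norm w)" if "t \<in> {0..1}" for t
      using that by (simp add: dist_norm mult_left_le_one_le)
    show "(F has_derivative DF z) (at z within cball y (norm w))" for z
      using F_deriv by (rule has_derivative_at_withinI)
    show "onorm (DF z - DF y) \<le> \<Lambda> * norm w" if "z \<in> cball y (norm w)" for z
      unfolding fun_diff_def
    proof (rule onorm_le)
      fix u
      have "norm (DF z u - DF y u) \<le> \<Lambda> * norm (z - y) * norm u" by (rule DF_lip)
      also have "\<dots> \<le> \<Lambda> * norm w * norm u"
        using that \<Lambda>_nonneg by (intro mult_right_mono mult_left_mono) (auto simp: dist_norm norm_minus_commute)
      finally show "norm (DF z u - DF y u) \<le> \<Lambda> * norm w * norm u" .
    qed
  qed auto
  then show ?thesis by (simp add: power2_eq_square mult_ac)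
qed

text \<open>Expansion along a curve leaving \<open>y\<close> with velocity \<open>v\<close>: the
  Taylor error costs \<open>\<Lambda> * (s * P)\<^sup>2\<close>, and replacing the displacement by
  \<open>s *\<^sub>R v\<close> inside \<open>DF\<close> costs \<open>s\<^sup>2 * R\<close>. It
  serves both the exact trajectory and the predictor.\<close>

lemma F_taylor_curve:
  assumes w: "norm w \<le> s * P" and sv: "norm (w - s *\<^sub>R v) \<le> s\<^sup>2 * R"
  shows "norm (F (y + w) - F y - s *\<^sub>R DF y v) \<le> s\<^sup>2 * (\<Lambda> * P\<^sup>2 + R)"
proof -
  interpret D: bounded_linear "DF y" by (rule bounded_linear_DF)
  have "norm (F (y + w) - F y - s *\<^sub>R DF y v)
      = norm ((F (y + w) - F y - DF y w) + DF y (w - s *\<^sub>R v))"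
    by (simp add: D.diff D.scaleR algebra_simps)
  also have "\<dots> \<le> \<Lambda> * (norm w)\<^sup>2 + norm (w - s *\<^sub>R v)"
    by (rule order_trans[OF norm_triangle_ineq add_mono[OF F_taylor DF_norm_le]])
  also have "\<dots> \<le> \<Lambda> * (s * P)\<^sup>2 + s\<^sup>2 * R"
    using w sv \<Lambda>_nonneg by (intro add_mono mult_left_mono power_mono) auto
  finally show ?thesis by (simp add: algebra_simps power_mult_distrib)
qed

text \<open>A step is \<open>base z + lift (slope z u)\<close>: only the slope depends on the random \<open>u\<close>.\<close>

definition pred :: "(real ^ 'd) \<times> (real ^ 'd) \<Rightarrow> real \<Rightarrow> real ^ 'd" where
  "pred z s = fst z + s *\<^sub>R snd z + (s\<^sup>2 / 2) *\<^sub>R F (fst z)"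

definition slope :: "(real ^ 'd) \<times> (real ^ 'd) \<Rightarrow> real \<Rightarrow> real ^ 'd" where
  "slope z u = (1 / (2 * u)) *\<^sub>R (F (pred z (u * h)) - F (fst z))"

definition base :: "(real ^ 'd) \<times> (real ^ 'd) \<Rightarrow> (real ^ 'd) \<times> (real ^ 'd)" where
  "base z = (fst z + h *\<^sub>R snd z + (h\<^sup>2 / 2) *\<^sub>R F (fst z), snd z + h *\<^sub>R F (fst z))"

definition lift :: "real ^ 'd \<Rightarrow> (real ^ 'd) \<times> (real ^ 'd)" where
  "lift w = ((h\<^sup>2 / 3) *\<^sub>R w, h *\<^sub>R w)"

text \<open>The weight in \<open>u\<close> is uniform: that is what the triangular density leaves
  after cancelling the denominator \<open>2 * u\<close> of \<open>slope\<close>.\<close>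

definition avg_F :: "(real ^ 'd) \<times> (real ^ 'd) \<Rightarrow> real ^ 'd" where
  "avg_F z = integral {0..1} (\<lambda>u. F (pred z (u * h)))"

text \<open>The expected step, written without probability so that its stability and its local error
  can be treated deterministically; \<open>integral_rrkn_step\<close> identifies it with the
  expectation.\<close>

definition mean_step :: "(real ^ 'd) \<times> (real ^ 'd) \<Rightarrow> (real ^ 'd) \<times> (real ^ 'd)" where
  "mean_step z = base z + lift (avg_F z - F (fst z))"

lemma rrkn_step_eq: "rrkn_step F h u z = base z + lift (slope z u)"
  by (cases z) (simp add: rrkn_step_def base_def lift_def slope_def pred_def Let_def field_simps)

lemma pred_0 [simp]: "pred z 0 = fst z"
  by (simp add: pred_def)

lemma continuous_on_pred [continuous_intros]:
  "continuous_on S f \<Longrightarrow> continuous_on S g \<Longrightarrow> continuous_on S (\<lambda>x. pred (f x) (g x))"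
  unfolding pred_def by (intro continuous_intros) auto

lemma bounded_linear_lift: "bounded_linear lift"
  unfolding lift_def by (intro bounded_linear_Pair bounded_linear_scaleR_right)

section \<open>Growth of one step and stability of its mean\<close>

lemma h_sq_le: "h\<^sup>2 \<le> h / 2"
  using h_le h_pos by (simp add: power2_eq_square)

lemma norm_lift_le: "norm (lift w) \<le> 7 / 6 * h * norm w"
proof -
  have "norm (lift w) \<le> h\<^sup>2 / 3 * norm w + h * norm w"
    unfolding lift_def using h_pos by (intro order_trans[OF norm_Pair_le]) auto
  also have "\<dots> \<le> (h / 2) / 3 * norm w + h * norm w"
    using h_sq_le by (intro add_mono mult_right_mono divide_right_mono) auto
  finally show ?thesis by (simp add: algebra_simps)
qed

lemma pred_diff_norm_le:
  assumes s: "0 \<le> s" "s \<le> h"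
  shows "norm (pred z s - fst z) \<le> s * (norm (snd z) + norm (fst z) / 4)"
proof -
  have "norm (pred z s - fst z) \<le> s * norm (snd z) + s\<^sup>2 / 2 * norm (F (fst z))"
    unfolding pred_def using s norm_triangle_ineq[of "s *\<^sub>R snd z" "(s\<^sup>2 / 2) *\<^sub>R F (fst z)"] by simp
  also have "s\<^sup>2 / 2 * norm (F (fst z)) \<le> s / 4 * norm (fst z)"
    using s h_le F_norm_le[of "fst z"] mult_left_mono[of s "1/2" s]
    by (intro mult_mono) (auto simp: power2_eq_square)
  finally show ?thesis by (simp add: algebra_simps)
qed

text \<open>The predictor moves by at most a multiple of \<open>u * h\<close>, so the Lipschitz
  bound supplies a factor \<open>u\<close> that cancels the denominator. The estimate is therefore
  uniform in the node.\<close>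

lemma norm_slope_le:
  assumes u: "0 < u" "u \<le> 1"
  shows "norm (slope z u) \<le> h / 2 * (norm (snd z) + norm (fst z) / 4)"
proof -
  have "norm (slope z u) = 1 / (2 * u) * norm (F (pred z (u * h)) - F (fst z))"
    using u by (simp add: slope_def)
  also have "\<dots> \<le> 1 / (2 * u) * norm (pred z (u * h) - fst z)"
    using u by (intro mult_left_mono F_lip) auto
  also have "\<dots> \<le> 1 / (2 * u) * ((u * h) * (norm (snd z) + norm (fst z) / 4))"
    using u h_pos by (intro mult_left_mono pred_diff_norm_le) (auto simp: mult_left_le_one_le)
  also have "\<dots> = h / 2 * (norm (snd z) + norm (fst z) / 4)"
    using u by simp
  finally show ?thesis .
qed

text \<open>Being uniform in the node, this bound can be iterated along almost every path; it keeps
  the chain in a fixed ball, where the fluctuation of each step is controlled.\<close>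

lemma norm_rrkn_step_le:
  assumes u: "0 < u" "u \<le> 1"
  shows "norm (rrkn_step F h u z) \<le> (1 + 2 * h) * norm z"
proof -
  let ?a = "norm (fst z)" and ?b = "norm (snd z)"
  have "rrkn_step F h u z = z + ((h *\<^sub>R snd z + (h\<^sup>2 / 2) *\<^sub>R F (fst z), h *\<^sub>R F (fst z)) + lift (slope z u))"
    by (simp add: rrkn_step_eq base_def prod_eq_iff)
  also have "norm \<dots> \<le> norm z + (norm (h *\<^sub>R snd z + (h\<^sup>2 / 2) *\<^sub>R F (fst z), h *\<^sub>R F (fst z)) + norm (lift (slope z u)))"
    by (intro norm_triangle_le add_left_mono norm_triangle_ineq)
  also have "norm (h *\<^sub>R snd z + (h\<^sup>2 / 2) *\<^sub>R F (fst z), h *\<^sub>R F (fst z)) \<le> h * ?b + h / 4 * ?a + h * ?a"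
  proof -
    have "norm (h *\<^sub>R snd z + (h\<^sup>2 / 2) *\<^sub>R F (fst z)) \<le> h * ?b + h\<^sup>2 / 2 * norm (F (fst z))"
      using h_pos by (intro order_trans[OF norm_triangle_ineq]) auto
    moreover have "h\<^sup>2 / 2 * norm (F (fst z)) \<le> h / 4 * ?a"
      using h_sq_le F_norm_le h_pos by (intro mult_mono) auto
    moreover have "norm (h *\<^sub>R F (fst z)) \<le> h * ?a"
      using F_norm_le h_pos by simp
    ultimately show ?thesis
      using norm_Pair_le[of "h *\<^sub>R snd z + (h\<^sup>2 / 2) *\<^sub>R F (fst z)" "h *\<^sub>R F (fst z)"] by linarith
  qed
  also have "norm (lift (slope z u)) \<le> h * (7 / 24 * (?b + ?a / 4))"
  proof -
    have "norm (lift (slope z u)) \<le> 7 / 6 * h * norm (slope z u)" by (rule norm_lift_le)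
    also have "\<dots> \<le> 7 / 6 * h * (h / 2 * (?b + ?a / 4))"
      using h_pos by (intro mult_left_mono norm_slope_le u) auto
    also have "\<dots> = 7 / 12 * h\<^sup>2 * (?b + ?a / 4)" by (simp add: power2_eq_square)
    also have "\<dots> \<le> 7 / 12 * (h / 2) * (?b + ?a / 4)"
      by (intro mult_right_mono mult_left_mono h_sq_le) auto
    finally show ?thesis by (simp add: algebra_simps)
  qed
  \<comment> \<open>The coefficient of \<open>?a\<close> is \<open>1 / 4 + 1 + 7 / 96\<close> and
    that of \<open>?b\<close> is \<open>1 + 7 / 24\<close>, both below \<open>1.4\<close>; then
    \<open>1.4 * 1.42\<close> is below \<open>2\<close>.\<close>
  also have "norm z + (h * ?b + h / 4 * ?a + h * ?a + h * (7 / 24 * (?b + ?a / 4)))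
      \<le> norm z + h * (1.4 * (?a + ?b))"
    unfolding ring_distribs
    using mult_nonneg_nonneg[OF less_imp_le[OF h_pos] norm_ge_zero, of "fst z"]
      mult_nonneg_nonneg[OF less_imp_le[OF h_pos] norm_ge_zero, of "snd z"]
    by linarith
  also have "\<dots> \<le> norm z + h * (2 * norm z)"
  proof -
    have "1.4 * (?a + ?b) \<le> 1.4 * (1.42 * norm z)"
      using norm_fst_add_norm_snd_le[of z] mult_right_mono[OF sqrt_2_le, of "norm z"] by simp
    also have "\<dots> \<le> 2 * norm z" by simp
    finally show ?thesis using h_pos by simp
  qed
  finally show ?thesis by (simp add: algebra_simps)
qed

lemma integrable_F_pred: "(\<lambda>u. F (pred z (u * h))) integrable_on {0..1}"
  by (intro integrable_continuous_interval continuous_intros)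

lemma pred_lipschitz:
  assumes s: "0 \<le> s" "s \<le> h"
  shows "norm (pred y s - pred z s) \<le> 9 / 8 * norm (fst (y - z)) + 1 / 2 * norm (snd (y - z))"
proof -
  have "pred y s - pred z s = fst (y - z) + s *\<^sub>R snd (y - z) + (s\<^sup>2 / 2) *\<^sub>R (F (fst y) - F (fst z))"
    by (simp add: pred_def algebra_simps)
  also have "norm \<dots> \<le> norm (fst (y - z)) + s * norm (snd (y - z)) + s\<^sup>2 / 2 * norm (F (fst y) - F (fst z))"
    using s by (intro norm_triangle_le add_mono order_trans[OF norm_triangle_ineq]) auto
  also have "s\<^sup>2 / 2 * norm (F (fst y) - F (fst z)) \<le> 1 / 8 * norm (fst (y - z))"
    using F_lip[of "fst y" "fst z"] power_mono[of s "1/2" 2] s h_le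
    by (intro mult_mono) (auto simp: power2_eq_square)
  also have "s * norm (snd (y - z)) \<le> 1 / 2 * norm (snd (y - z))"
    using s h_le by (intro mult_right_mono) auto
  finally show ?thesis by simp
qed

lemma avg_F_lipschitz:
  "norm (avg_F y - avg_F z) \<le> 9 / 8 * norm (fst (y - z)) + 1 / 2 * norm (snd (y - z))"
    (is "_ \<le> ?B")
proof -
  have "norm (integral {0..1} (\<lambda>u. F (pred y (u * h)) - F (pred z (u * h)))) \<le> integral {0..1} (\<lambda>u::real. ?B)"
  proof (rule integral_norm_bound_integral)
    show "norm (F (pred y (u * h)) - F (pred z (u * h))) \<le> ?B" if "u \<in> {0..1}" for u
      using that h_pos
      by (intro order_trans[OF F_lip] pred_lipschitz) (auto simp: mult_left_le_one_le)
  qed (auto intro!: integrable_diff integrable_F_pred)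
  then show ?thesis
    by (simp add: avg_F_def integral_diff integrable_F_pred)
qed

text \<open>The velocity terms \<open>h *\<^sub>R F (fst z)\<close> cancel, and in the position
  \<open>1 / 2 - 1 / 3 = 1 / 6\<close> of the force remains.\<close>

lemma mean_step_eq:
  "mean_step z = (fst z + h *\<^sub>R snd z + (h\<^sup>2 / 6) *\<^sub>R F (fst z) + (h\<^sup>2 / 3) *\<^sub>R avg_F z, snd z + h *\<^sub>R avg_F z)"
proof -
  have "(h\<^sup>2 / 2) *\<^sub>R F (fst z) - (h\<^sup>2 / 3) *\<^sub>R F (fst z) = (h\<^sup>2 / 6) *\<^sub>R F (fst z)"
    by (simp flip: scaleR_diff_left)
  then show ?thesis
    by (simp add: mean_step_def base_def lift_def algebra_simps)
qed

text \<open>Only \<open>F\<close> and its average occur in the mean, with no division by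
  \<open>u\<close>, so the Lipschitz bound of \<open>F\<close> suffices and no second-order
  information enters.\<close>

lemma mean_step_lipschitz: "norm (mean_step y - mean_step z) \<le> (1 + 5 / 2 * h) * norm (y - z)"
proof -
  let ?a = "norm (fst (y - z))" and ?b = "norm (snd (y - z))"
  let ?F = "F (fst y) - F (fst z)" and ?I = "avg_F y - avg_F z"
  have I: "norm ?I \<le> 9 / 8 * ?a + 1 / 2 * ?b" by (rule avg_F_lipschitz)
  have Fl: "norm ?F \<le> ?a" using F_lip[of "fst y" "fst z"] by simp
  have "mean_step y - mean_step z = (y - z) +
      (h *\<^sub>R snd (y - z) + (h\<^sup>2 / 6) *\<^sub>R ?F + (h\<^sup>2 / 3) *\<^sub>R ?I, h *\<^sub>R ?I)"
    by (simp add: mean_step_eq prod_eq_iff algebra_simps)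
  also have "norm \<dots> \<le> norm (y - z) +
      (norm (h *\<^sub>R snd (y - z) + (h\<^sup>2 / 6) *\<^sub>R ?F + (h\<^sup>2 / 3) *\<^sub>R ?I) + norm (h *\<^sub>R ?I))"
    by (intro norm_triangle_le add_left_mono norm_Pair_le)
  also have "norm (h *\<^sub>R snd (y - z) + (h\<^sup>2 / 6) *\<^sub>R ?F + (h\<^sup>2 / 3) *\<^sub>R ?I)
      \<le> h * ?b + h\<^sup>2 / 6 * norm ?F + h\<^sup>2 / 3 * norm ?I"
    using h_pos by (intro norm_triangle_le add_mono order_trans[OF norm_triangle_ineq]) auto
  also have "h\<^sup>2 / 6 * norm ?F \<le> h / 12 * ?a"
    using h_sq_le Fl h_pos by (intro mult_mono) auto
  also have "h\<^sup>2 / 3 * norm ?I \<le> h / 6 * (9 / 8 * ?a + 1 / 2 * ?b)"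
    using h_sq_le I h_pos by (intro mult_mono) auto
  also have "norm (h *\<^sub>R ?I) \<le> h * (9 / 8 * ?a + 1 / 2 * ?b)"
    using I h_pos by simp
  \<comment> \<open>The coefficients are \<open>1 / 12 + 3 / 16 + 9 / 8\<close> for
    \<open>?a\<close> and \<open>1 + 1 / 12 + 1 / 2\<close> for \<open>?b\<close>, both below
    \<open>1.6\<close>; then \<open>1.6 * 1.42\<close> is below \<open>5 / 2\<close>.\<close>
  also have "norm (y - z) + (h * ?b + h / 12 * ?a + h / 6 * (9 / 8 * ?a + 1 / 2 * ?b) + h * (9 / 8 * ?a + 1 / 2 * ?b))
      \<le> norm (y - z) + h * (1.6 * (?a + ?b))"
    unfolding ring_distribs
    using mult_nonneg_nonneg[OF less_imp_le[OF h_pos] norm_ge_zero, of "fst (y - z)"]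
      mult_nonneg_nonneg[OF less_imp_le[OF h_pos] norm_ge_zero, of "snd (y - z)"]
    by linarith
  also have "\<dots> \<le> norm (y - z) + h * (5 / 2 * norm (y - z))"
  proof -
    have "1.6 * (?a + ?b) \<le> 1.6 * (1.42 * norm (y - z))"
      using norm_fst_add_norm_snd_le[of "y - z"] mult_right_mono[OF sqrt_2_le, of "norm (y - z)"] by simp
    also have "\<dots> \<le> 5 / 2 * norm (y - z)" by simp
    finally show ?thesis using h_pos by simp
  qed
  finally show ?thesis by (simp add: algebra_simps)
qed

end

section \<open>The exact flow\<close>

lemma norm_diff_le_vector_derivative:
  fixes f :: "real \<Rightarrow> 'a::real_normed_vector"
  assumes s: "0 \<le> s"
    and f': "\<And>r. 0 \<le> r \<Longrightarrow> r \<le> s \<Longrightarrow> (f has_vector_derivative f' r) (at r within {0..s})"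
    and le: "\<And>r. 0 \<le> r \<Longrightarrow> r \<le> s \<Longrightarrow> norm (f' r) \<le> C"
  shows "norm (f s - f 0) \<le> s * C"
proof -
  have "norm (f s - f 0) \<le> C * norm (s - 0)"
  proof (rule differentiable_bound[where S = "{0..s}" and f' = "\<lambda>r x. x *\<^sub>R f' r"])
    show "onorm (\<lambda>x. x *\<^sub>R f' r) \<le> C" if "r \<in> {0..s}" for r
      using le[of r] that by (intro onorm_le) (auto simp: mult.commute[of C] intro: mult_left_mono)
  qed (use s f' in \<open>auto simp: has_vector_derivative_def\<close>)
  then show ?thesis using s by (simp add: mult.commute)
qed

lemma norm_has_integral_unit_interval_le:
  fixes f :: "real \<Rightarrow> 'a::real_normed_vector"
  assumes i: "(f has_integral i) {0..1}" and le: "\<And>u. u \<in> {0..1} \<Longrightarrow> norm (f u) \<le> B"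
  shows "norm i \<le> B"
proof -
  have "0 \<le> B" using le[of 0] by (simp add: order_trans[OF norm_ge_zero])
  then show ?thesis
    using has_integral_bound_real[OF _ finite.emptyI i, of B] le by simp
qed

text \<open>Chain rule for an affine change of time that stays in \<open>{0..}\<close>, where the
  derivatives are taken. The choice \<open>c = 1\<close> shifts the origin of time;
  \<open>c = h\<close> parametrizes one step by the unit interval.\<close>

lemma exact_flow_has_vector_derivative:
  assumes flow: "exact_flow_from F x v q p" and "t \<ge> 0" "c \<ge> 0" "r \<ge> 0"
  shows "((\<lambda>r. q (t + r * c)) has_vector_derivative c *\<^sub>R p (t + r * c)) (at r within {0..b})"
    and "((\<lambda>r. p (t + r * c)) has_vector_derivative c *\<^sub>R F (q (t + r * c))) (at r within {0..b})"
proof -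
  have aff: "((\<lambda>r. t + r * c) has_vector_derivative c) (at r within {0..b})"
    by (auto intro!: derivative_eq_intros)
  have sub: "(\<lambda>r. t + r * c) ` {0..b} \<subseteq> {0..}" using assms by auto
  have nn: "t + r * c \<ge> 0" using assms by simp
  have "(q has_vector_derivative p (t + r * c)) (at (t + r * c) within (\<lambda>r. t + r * c) ` {0..b})"
    "(p has_vector_derivative F (q (t + r * c))) (at (t + r * c) within (\<lambda>r. t + r * c) ` {0..b})"
    using flow nn sub by (auto simp: exact_flow_from_def intro: has_vector_derivative_within_subset)
  from this[THEN vector_diff_chain_within[OF aff]]
  show "((\<lambda>r. q (t + r * c)) has_vector_derivative c *\<^sub>R p (t + r * c)) (at r within {0..b})"
    "((\<lambda>r. p (t + r * c)) has_vector_derivative c *\<^sub>R F (q (t + r * c))) (at r within {0..b})"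
    by (simp_all add: o_def)
qed

context lipschitz_force
begin

text \<open>Gronwall's argument: the derivative of the squared norm is at most twice the squared
  norm, by Cauchy-Schwarz and \<open>F_norm_le\<close>. Hence \<open>E\<close>, the squared norm
  damped by \<open>exp (- 2 * s)\<close>, cannot increase, which the mean value theorem turns into
  \<open>E t\<close> \<le> \<open>E 0\<close>.\<close>

lemma exact_flow_norm_le:
  assumes flow: "exact_flow_from F x v q p" and t: "t \<ge> 0"
  shows "norm (q t, p t) \<le> exp t * norm (x, v)"
proof (cases "t = 0")
  case True
  then show ?thesis using flow by (simp add: exact_flow_from_def)
next
  case False
  with t have "0 < t" by simp
  define E where "E = (\<lambda>s. exp (- 2 * s) * (q s \<bullet> q s + p s \<bullet> p s))"
  define E' where "E' = (\<lambda>s. exp (- 2 * s) * (2 * (p s \<bullet> q s) + 2 * (F (q s) \<bullet> p s)) - 2 * exp (- 2 * s) * (q s \<bullet> q s + p s \<bullet> p s))"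
  note d = exact_flow_has_vector_derivative[OF flow, where c = 1 and t = 0, simplified]
  have "(E has_derivative (\<lambda>x. x * E' s)) (at s within {0..t})" if "s \<in> {0..t}" for s
  proof -
    have "((\<lambda>s. q s \<bullet> q s) has_real_derivative q s \<bullet> p s + p s \<bullet> q s) (at s within {0..t})"
      and "((\<lambda>s. p s \<bullet> p s) has_real_derivative p s \<bullet> F (q s) + F (q s) \<bullet> p s) (at s within {0..t})"
      using bounded_bilinear.has_vector_derivative[OF bounded_bilinear_inner d(1) d(1), of s t]
        bounded_bilinear.has_vector_derivative[OF bounded_bilinear_inner d(2) d(2), of s t] that
      by (simp_all add: has_real_derivative_iff_has_vector_derivative)
    note sum = DERIV_add[OF this]
    have "((\<lambda>s. exp (- 2 * s)) has_real_derivative - 2 * exp (- 2 * s)) (at s within {0..t})"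
      by (auto intro!: derivative_eq_intros)
    from DERIV_mult[OF this sum]
    have "(E has_real_derivative E' s) (at s within {0..t})"
      unfolding E_def by (rule DERIV_cong) (simp add: E'_def inner_commute algebra_simps)
    then show ?thesis by (simp add: has_field_derivative_def mult_commute_abs)
  qed
  then obtain s where s: "s \<in> {0<..<t}" and eq: "E t - E 0 = (t - 0) * E' s"
    using mvt_simple[OF \<open>0 < t\<close>, of E "\<lambda>s x. x * E' s"] by auto
  have "p s \<bullet> q s + F (q s) \<bullet> p s \<le> norm (p s) * norm (q s) + norm (F (q s)) * norm (p s)"
    by (intro add_mono norm_cauchy_schwarz)
  also have "norm (F (q s)) * norm (p s) \<le> norm (q s) * norm (p s)"
    by (intro mult_right_mono F_norm_le) auto
  also have "norm (p s) * norm (q s) + norm (q s) * norm (p s) \<le> q s \<bullet> q s + p s \<bullet> p s"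
    using sum_squares_bound[of "norm (q s)" "norm (p s)"] by (simp add: dot_square_norm mult_ac)
  finally have "2 * exp (- 2 * s) * ((p s \<bullet> q s + F (q s) \<bullet> p s) - (q s \<bullet> q s + p s \<bullet> p s)) \<le> 0"
    by (intro mult_nonneg_nonpos) auto
  then have "E' s \<le> 0"
    by (simp add: E'_def algebra_simps)
  with eq \<open>0 < t\<close> have "E t \<le> E 0"
    using mult_nonneg_nonpos[of t "E' s"] by simp
  then have "exp (- 2 * t) * (norm (q t, p t))\<^sup>2 \<le> (norm (x, v))\<^sup>2"
    using flow by (simp add: E_def norm_prod_def dot_square_norm exact_flow_from_def)
  then have "(norm (q t, p t))\<^sup>2 \<le> exp (2 * t) * (norm (x, v))\<^sup>2"
    by (simp add: exp_minus field_simps)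
  also have "\<dots> = (exp t * norm (x, v))\<^sup>2"
    by (simp add: power_mult_distrib flip: exp_double)
  finally show ?thesis by (rule power2_le_imp_le) simp
qed

text \<open>Both exact increments are integrals of the force along the trajectory. The velocity sees
  only the cubic error of the predictor; in the position the first-order variation of the force
  cancels as well, so that both components are off by order \<open>h ^ 4\<close>.\<close>

lemma mean_step_local_error:
  assumes flow: "exact_flow_from F x v q p" and t: "t \<ge> 0"
    and B: "\<And>s. 0 \<le> s \<Longrightarrow> s \<le> h \<Longrightarrow> norm (q (t + s), p (t + s)) \<le> B"
  shows "norm (mean_step (q t, p t) - (q (t + h), p (t + h)))
    \<le> h ^ 4 * (11 / 6 * B + 2 / 3 * \<Lambda> * B\<^sup>2)"
proof -
  let ?F0 = "F (q t)" and ?pred = "pred (q t, p t)" and ?D = "DF (q t) (p t)"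
  note d1 = exact_flow_has_vector_derivative[OF flow t, where c = 1, simplified]
  note dh = exact_flow_has_vector_derivative[OF flow t less_imp_le[OF h_pos]]
  have B0: "0 \<le> B" using B[of 0] h_pos by (smt (verit) norm_ge_zero)
  have qB: "norm (q (t + s)) \<le> B" and pB: "norm (p (t + s)) \<le> B" if "0 \<le> s" "s \<le> h" for s
    using B[OF that] norm_fst_le[of "q (t + s)" "p (t + s)"] norm_snd_le[of "p (t + s)" "q (t + s)"] by auto
  have q1: "norm (q (t + s) - q t) \<le> s * B" if s: "0 \<le> s" "s \<le> h" for s
    using norm_diff_le_vector_derivative[OF s(1) d1(1) pB] s by simp
  have p1: "norm (p (t + s) - p t) \<le> s * B" if s: "0 \<le> s" "s \<le> h" for s
    using norm_diff_le_vector_derivative[OF s(1) d1(2) order_trans[OF F_norm_le qB]] s by simp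
  have q2: "norm (q (t + s) - q t - s *\<^sub>R p t) \<le> s\<^sup>2 * B" if s: "0 \<le> s" "s \<le> h" for s
  proof -
    have "norm ((q (t + s) - s *\<^sub>R p t) - (q (t + 0) - 0 *\<^sub>R p t)) \<le> s * (s * B)"
    proof (rule norm_diff_le_vector_derivative[OF s(1)])
      fix r assume r: "0 \<le> r" "r \<le> s"
      show "((\<lambda>r. q (t + r) - r *\<^sub>R p t) has_vector_derivative p (t + r) - p t) (at r within {0..s})"
        using r by (auto intro!: derivative_eq_intros d1)
      show "norm (p (t + r) - p t) \<le> s * B"
        using p1[of r] r s B0 by (auto intro: order_trans mult_right_mono)
    qed
    then show ?thesis by (simp add: algebra_simps power2_eq_square)
  qed
  have p2: "norm (p (t + s) - p t - s *\<^sub>R ?F0) \<le> s\<^sup>2 * B" if s: "0 \<le> s" "s \<le> h" for s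
  proof -
    have "norm ((p (t + s) - s *\<^sub>R ?F0) - (p (t + 0) - 0 *\<^sub>R ?F0)) \<le> s * (s * B)"
    proof (rule norm_diff_le_vector_derivative[OF s(1)])
      fix r assume r: "0 \<le> r" "r \<le> s"
      show "((\<lambda>r. p (t + r) - r *\<^sub>R ?F0) has_vector_derivative F (q (t + r)) - ?F0) (at r within {0..s})"
        using r by (auto intro!: derivative_eq_intros d1)
      show "norm (F (q (t + r)) - ?F0) \<le> s * B"
        using order_trans[OF F_lip q1[of r]] r s B0 by (auto intro: order_trans mult_right_mono)
    qed
    then show ?thesis by (simp add: algebra_simps power2_eq_square)
  qed
  \<comment> \<open>The predictor is the second-order Taylor polynomial of \<open>q\<close> at
    \<open>t\<close>. The derivative of the difference is the remainder estimated in
    \<open>p2\<close>.\<close>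
  have pred: "norm (?pred s - q (t + s)) \<le> s ^ 3 * B" if s: "0 \<le> s" "s \<le> h" for s
  proof -
    have "norm ((?pred s - q (t + s)) - (?pred 0 - q (t + 0))) \<le> s * (s\<^sup>2 * B)"
    proof (rule norm_diff_le_vector_derivative[OF s(1)])
      fix r assume r: "0 \<le> r" "r \<le> s"
      show "((\<lambda>r. ?pred r - q (t + r)) has_vector_derivative p t + r *\<^sub>R ?F0 - p (t + r)) (at r within {0..s})"
        using r unfolding pred_def by (auto intro!: derivative_eq_intros d1)
      have "norm (p t + r *\<^sub>R ?F0 - p (t + r)) = norm (p (t + r) - p t - r *\<^sub>R ?F0)"
        using norm_minus_commute[of "p t + r *\<^sub>R ?F0" "p (t + r)"] by (simp add: algebra_simps)
      also have "\<dots> \<le> r\<^sup>2 * B" using r s by (intro p2) auto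
      also have "\<dots> \<le> s\<^sup>2 * B" using r s B0 by (intro mult_right_mono power_mono) auto
      finally show "norm (p t + r *\<^sub>R ?F0 - p (t + r)) \<le> s\<^sup>2 * B" .
    qed
    then show ?thesis by (simp add: power2_eq_square power3_eq_cube mult_ac)
  qed
  have uh: "0 \<le> u * h" "u * h \<le> h" if "u \<in> {0..1}" for u
    using that h_pos by (auto simp: mult_left_le_one_le)
  have pred': "norm (F (?pred (u * h)) - F (q (t + u * h))) \<le> h ^ 3 * B" if u: "u \<in> {0..1}" for u
  proof -
    have "norm (F (?pred (u * h)) - F (q (t + u * h))) \<le> (u * h) ^ 3 * B"
      using uh[OF u] by (intro order_trans[OF F_lip] pred) auto
    also have "\<dots> \<le> h ^ 3 * B"
      using uh[OF u] B0 by (intro mult_right_mono power_mono) auto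
    finally show ?thesis .
  qed
  define R where "R = (\<lambda>u. F (q (t + u * h)) - ?F0 - (u * h) *\<^sub>R ?D)"
  have R: "norm (R u) \<le> h\<^sup>2 * (\<Lambda> * B\<^sup>2 + B)" if u: "u \<in> {0..1}" for u
  proof -
    have "norm (R u) \<le> (u * h)\<^sup>2 * (\<Lambda> * B\<^sup>2 + B)"
      using F_taylor_curve[OF q1[OF uh[OF u]] q2[OF uh[OF u]], of "q t"] by (simp add: R_def)
    also have "\<dots> \<le> h\<^sup>2 * (\<Lambda> * B\<^sup>2 + B)"
      using uh[OF u] B0 \<Lambda>_nonneg by (intro mult_right_mono power_mono) auto
    finally show ?thesis .
  qed
  have avg: "((\<lambda>u. F (?pred (u * h))) has_integral avg_F (q t, p t)) {0..1}"
    unfolding avg_F_def using integrable_F_pred by (rule integrable_integral)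
  \<comment> \<open>The exact velocity increment is the same average of \<open>F\<close> with the
    trajectory in place of the predictor.\<close>
  have "((\<lambda>u. h *\<^sub>R F (q (t + u * h))) has_integral p (t + 1 * h) - p (t + 0 * h)) {0..1}"
    by (rule fundamental_theorem_of_calculus) (auto intro!: dh)
  from has_integral_diff[OF has_integral_cmul[OF avg, of h] this]
  have "norm (h *\<^sub>R avg_F (q t, p t) - (p (t + 1 * h) - p (t + 0 * h))) \<le> h * (h ^ 3 * B)"
  proof (rule norm_has_integral_unit_interval_le)
    fix u :: real assume "u \<in> {0..1}"
    then show "norm (h *\<^sub>R F (?pred (u * h)) - h *\<^sub>R F (q (t + u * h))) \<le> h * (h ^ 3 * B)"
      using pred'[of u] h_pos by (simp flip: scaleR_diff_right)
  qed
  then have V: "norm (snd (mean_step (q t, p t)) - p (t + h)) \<le> h ^ 4 * B"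
    by (simp add: mean_step_eq algebra_simps eval_nat_numeral)
  \<comment> \<open>Taylor's formula for \<open>q\<close> with integral remainder; the
    antiderivative interpolates between \<open>q + h *\<^sub>R p\<close> at the old time and
    \<open>q\<close> at the new one.\<close>
  have "((\<lambda>u. ((1 - u) * h\<^sup>2) *\<^sub>R F (q (t + u * h))) has_integral
      (q (t + 1 * h) + ((1 - 1) * h) *\<^sub>R p (t + 1 * h)) - (q (t + 0 * h) + ((1 - 0) * h) *\<^sub>R p (t + 0 * h))) {0..1}"
  proof (rule fundamental_theorem_of_calculus)
    fix u :: real assume "u \<in> {0..1}"
    then show "((\<lambda>u. q (t + u * h) + ((1 - u) * h) *\<^sub>R p (t + u * h)) has_vector_derivative
        ((1 - u) * h\<^sup>2) *\<^sub>R F (q (t + u * h))) (at u within {0..1})"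
      by (auto intro!: derivative_eq_intros dh simp: power2_eq_square algebra_simps)
  qed simp
  note i1 = has_integral_diff[OF has_integral_cmul[OF avg, of "h\<^sup>2 / 3"] this]
  \<comment> \<open>The kernel is \<open>1 / 3 - (1 - u)\<close>, the weight of the scheme minus the
    weight in Taylor's formula. Its moments of order zero and one are \<open>- 1 / 6\<close> and
    \<open>0\<close>.\<close>
  have w1: "((\<lambda>u::real. u - 2 / 3) has_integral (1\<^sup>2 / 2 - 2 / 3 * 1) - (0\<^sup>2 / 2 - 2 / 3 * 0)) {0..1}"
    by (rule fundamental_theorem_of_calculus)
      (auto intro!: derivative_eq_intros simp flip: has_real_derivative_iff_has_vector_derivative)
  have w2: "((\<lambda>u::real. (u - 2 / 3) * u) has_integral (1 ^ 3 / 3 - 1\<^sup>2 / 3) - (0 ^ 3 / 3 - 0\<^sup>2 / 3)) {0..1}"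
    by (rule fundamental_theorem_of_calculus)
      (auto intro!: derivative_eq_intros simp: power2_eq_square field_simps
        simp flip: has_real_derivative_iff_has_vector_derivative)
  note i2 = has_integral_diff[OF has_integral_diff[OF i1 has_integral_scaleR_left[OF w1, of "h\<^sup>2 *\<^sub>R ?F0"]]
      has_integral_scaleR_left[OF w2, of "h ^ 3 *\<^sub>R ?D"]]
  let ?err = "fst (mean_step (q t, p t)) - q (t + h)"
  \<comment> \<open>The position error has the kernel \<open>u - 2 / 3\<close>. Against it the force at time \<open>t\<close> contributes
    \<open>- 1 / 6\<close>, which the term \<open>h\<^sup>2 / 6\<close> of the mean step compensates, and the first-order term integrates to zero,
    so that only the Taylor remainder is left.\<close>
  have f_eq: "(h\<^sup>2 / 3) *\<^sub>R fp - ((1 - u) * h\<^sup>2) *\<^sub>R fq - (u - 2 / 3) *\<^sub>R (h\<^sup>2 *\<^sub>R f0) - ((u - 2 / 3) * u) *\<^sub>R (h ^ 3 *\<^sub>R d)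
      = (h\<^sup>2 / 3) *\<^sub>R (fp - fq) + ((u - 2 / 3) * h\<^sup>2) *\<^sub>R (fq - f0 - (u * h) *\<^sub>R d)"
    for u and fp fq f0 d :: "real ^ 'd"
    unfolding vec_eq_iff vector_minus_component vector_add_component vector_scaleR_component real_scaleR_def
    by (intro allI) algebra
  have i_eq: "(h\<^sup>2 / 3) *\<^sub>R a - ((q1 + ((1 - 1) * h) *\<^sub>R p1) - (q0 + ((1 - 0) * h) *\<^sub>R p0))
      - (1\<^sup>2 / 2 - 2 / 3 * 1 - (0\<^sup>2 / 2 - 2 / 3 * 0)) *\<^sub>R (h\<^sup>2 *\<^sub>R f0)
      - (1 ^ 3 / 3 - 1\<^sup>2 / 3 - (0 ^ 3 / 3 - 0\<^sup>2 / 3)) *\<^sub>R (h ^ 3 *\<^sub>R d)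
      = q0 + h *\<^sub>R p0 + (h\<^sup>2 / 6) *\<^sub>R f0 + (h\<^sup>2 / 3) *\<^sub>R a - q1"
    for a q0 q1 p0 p1 f0 d :: "real ^ 'd"
    unfolding vec_eq_iff vector_minus_component vector_add_component vector_scaleR_component real_scaleR_def
    by (simp add: field_simps)
  have "((\<lambda>u. (h\<^sup>2 / 3) *\<^sub>R (F (?pred (u * h)) - F (q (t + u * h))) + ((u - 2 / 3) * h\<^sup>2) *\<^sub>R R u) has_integral ?err) {0..1}"
    using i2 unfolding f_eq i_eq R_def mean_step_eq fst_conv snd_conv mult_1 mult_zero_left add_0_right .
  then have "norm ?err \<le> (h\<^sup>2 / 3 * (h ^ 3 * B) + 2 / 3 * h\<^sup>2 * (h\<^sup>2 * (\<Lambda> * B\<^sup>2 + B)))"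
  proof (rule norm_has_integral_unit_interval_le)
    fix u :: real assume u: "u \<in> {0..1}"
    have "norm ((h\<^sup>2 / 3) *\<^sub>R (F (?pred (u * h)) - F (q (t + u * h)))) \<le> h\<^sup>2 / 3 * (h ^ 3 * B)"
      unfolding norm_scaleR using pred'[of u] u by (intro mult_mono) auto
    moreover have "norm (((u - 2 / 3) * h\<^sup>2) *\<^sub>R R u) \<le> 2 / 3 * h\<^sup>2 * (h\<^sup>2 * (\<Lambda> * B\<^sup>2 + B))"
      unfolding norm_scaleR abs_mult using R[of u] u by (intro mult_mono) (auto simp: abs_if)
    ultimately show "norm ((h\<^sup>2 / 3) *\<^sub>R (F (?pred (u * h)) - F (q (t + u * h))) + ((u - 2 / 3) * h\<^sup>2) *\<^sub>R R u)
        \<le> h\<^sup>2 / 3 * (h ^ 3 * B) + 2 / 3 * h\<^sup>2 * (h\<^sup>2 * (\<Lambda> * B\<^sup>2 + B))"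
      by (rule norm_triangle_mono)
  qed
  also have "\<dots> = h * (h ^ 4 * B) / 3 + 2 / 3 * h ^ 4 * (\<Lambda> * B\<^sup>2 + B)"
    by (simp add: algebra_simps eval_nat_numeral)
  also have "h * (h ^ 4 * B) \<le> 1 / 2 * (h ^ 4 * B)"
    using h_le B0 by (intro mult_right_mono) auto
  finally have Q: "norm ?err \<le> 1 / 2 * (h ^ 4 * B) / 3 + 2 / 3 * h ^ 4 * (\<Lambda> * B\<^sup>2 + B)" by simp
  have "norm (mean_step (q t, p t) - (q (t + h), p (t + h))) \<le> norm ?err + norm (snd (mean_step (q t, p t)) - p (t + h))"
    using norm_Pair_le[of ?err] by (simp add: minus_prod_def)
  also have "\<dots> \<le> 1 / 2 * (h ^ 4 * B) / 3 + 2 / 3 * h ^ 4 * (\<Lambda> * B\<^sup>2 + B) + h ^ 4 * B"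
    using Q V by (rule add_mono)
  \<comment> \<open>The coefficient of \<open>B\<close> collects \<open>1 / 6\<close> from the
    predictor in the position, \<open>2 / 3\<close> from the remainder \<open>R\<close> and
    \<open>1\<close> from the velocity.\<close>
  also have "\<dots> = h ^ 4 * (11 / 6 * B + 2 / 3 * \<Lambda> * B\<^sup>2)"
    by algebra
  finally show ?thesis .
qed

end

section \<open>Randomization\<close>

text \<open>The bias-variance decomposition: the expansion \<open>*\<close> is used once at
  \<open>c\<close> and once at the mean.\<close>

lemma (in prob_space) integral_norm_diff_sq:
  fixes X :: "'a \<Rightarrow> 'b::euclidean_space"
  assumes X: "integrable M X" and X2: "integrable M (\<lambda>\<omega>. (norm (X \<omega>))\<^sup>2)"
  shows "(\<integral>\<omega>. (norm (X \<omega> - c))\<^sup>2 \<partial>M)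
    = (norm (integral\<^sup>L M X - c))\<^sup>2 + (\<integral>\<omega>. (norm (X \<omega> - integral\<^sup>L M X))\<^sup>2 \<partial>M)"
proof -
  have *: "(\<integral>\<omega>. (norm (X \<omega> - c))\<^sup>2 \<partial>M)
      = (\<integral>\<omega>. (norm (X \<omega>))\<^sup>2 \<partial>M) - 2 * (integral\<^sup>L M X \<bullet> c) + (norm c)\<^sup>2" for c
  proof -
    have "(\<lambda>\<omega>. (norm (X \<omega> - c))\<^sup>2) = (\<lambda>\<omega>. (norm (X \<omega>))\<^sup>2 - 2 * (X \<omega> \<bullet> c) + (norm c)\<^sup>2)"
      by (simp add: power2_norm_eq_inner inner_diff_left inner_diff_right inner_commute algebra_simps)
    then show ?thesis using X X2 by (simp add: prob_space)
  qed
  show ?thesis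
    unfolding *[of c] *[of "integral\<^sup>L M X"]
    by (simp add: power2_norm_eq_inner inner_diff_left inner_diff_right inner_commute algebra_simps)
qed

text \<open>The mean minimizes the mean square distance, so the variance can be estimated around any
  convenient centre \<open>d\<close>.\<close>

lemma (in prob_space) integral_norm_diff_sq_le:
  fixes X :: "'a \<Rightarrow> 'b::euclidean_space"
  assumes X: "integrable M X" and X2: "integrable M (\<lambda>\<omega>. (norm (X \<omega>))\<^sup>2)"
    and d: "AE \<omega> in M. norm (X \<omega> - d) \<le> \<sigma>"
  shows "(\<integral>\<omega>. (norm (X \<omega> - c))\<^sup>2 \<partial>M) \<le> (norm (integral\<^sup>L M X - c))\<^sup>2 + \<sigma>\<^sup>2"
proof -
  have [measurable]: "X \<in> borel_measurable M" using X by auto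
  have sq: "AE \<omega> in M. (norm (X \<omega> - d))\<^sup>2 \<le> \<sigma>\<^sup>2"
    using d by eventually_elim (simp add: power_mono)
  then have "integrable M (\<lambda>\<omega>. (norm (X \<omega> - d))\<^sup>2)"
    by (intro integrable_const_bound[of _ "\<sigma>\<^sup>2"]) auto
  then have "(\<integral>\<omega>. (norm (X \<omega> - d))\<^sup>2 \<partial>M) \<le> (\<integral>\<omega>. \<sigma>\<^sup>2 \<partial>M)"
    using sq by (intro integral_mono_AE) auto
  then have "(\<integral>\<omega>. (norm (X \<omega> - integral\<^sup>L M X))\<^sup>2 \<partial>M) \<le> \<sigma>\<^sup>2"
    using integral_norm_diff_sq[OF X X2, of d] by (simp add: prob_space add_nonneg_eq_0_iff) (smt (verit) zero_le_power2)
  then show ?thesis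
    using integral_norm_diff_sq[OF X X2, of c] by simp
qed

text \<open>By independence the joint law is a product, and Fubini applies. This takes the place of
  conditioning on \<open>Z\<close>.\<close>

lemma (in prob_space)
  fixes f :: "'b \<times> 'b \<Rightarrow> real"
  assumes ind: "indep_var S Z T Y" and f [measurable]: "f \<in> borel_measurable (S \<Otimes>\<^sub>M T)"
    and int: "integrable M (\<lambda>\<omega>. f (Z \<omega>, Y \<omega>))"
  shows integrable_indep_var_integral: "integrable M (\<lambda>\<omega>. \<integral>\<omega>'. f (Z \<omega>, Y \<omega>') \<partial>M)"
    and integral_indep_var: "(\<integral>\<omega>. f (Z \<omega>, Y \<omega>) \<partial>M) = (\<integral>\<omega>. (\<integral>\<omega>'. f (Z \<omega>, Y \<omega>') \<partial>M) \<partial>M)"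
proof -
  have Z [measurable]: "Z \<in> measurable M S" and Y [measurable]: "Y \<in> measurable M T"
    and eq: "distr M S Z \<Otimes>\<^sub>M distr M T Y = distr M (S \<Otimes>\<^sub>M T) (\<lambda>\<omega>. (Z \<omega>, Y \<omega>))"
    using ind by (auto simp: indep_var_distribution_eq)
  interpret Z: prob_space "distr M S Z" by (rule prob_space_distr) fact
  interpret Y: prob_space "distr M T Y" by (rule prob_space_distr) fact
  interpret P: pair_sigma_finite "distr M S Z" "distr M T Y" ..
  have I: "integrable (distr M S Z \<Otimes>\<^sub>M distr M T Y) f"
    unfolding eq using int by (simp add: integrable_distr_eq)
  have inner: "(\<integral>y. f (Z \<omega>, y) \<partial>distr M T Y) = (\<integral>\<omega>'. f (Z \<omega>, Y \<omega>') \<partial>M)" if "\<omega> \<in> space M" for \<omega>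
    using measurable_space[OF Z that] by (intro integral_distr) measurable
  have [measurable]: "(\<lambda>z. \<integral>y. f (z, y) \<partial>distr M T Y) \<in> borel_measurable S"
    using Y.borel_measurable_lebesgue_integral[of "\<lambda>z y. f (z, y)" S] by simp
  have "integrable M (\<lambda>\<omega>. \<integral>y. f (Z \<omega>, y) \<partial>distr M T Y)"
    using P.integrable_fst'[OF I] by (simp add: integrable_distr_eq)
  then show "integrable M (\<lambda>\<omega>. \<integral>\<omega>'. f (Z \<omega>, Y \<omega>') \<partial>M)"
    by (simp add: inner cong: Bochner_Integration.integrable_cong)
  have "(\<integral>\<omega>. f (Z \<omega>, Y \<omega>) \<partial>M) = (\<integral>\<omega>. (\<integral>y. f (Z \<omega>, y) \<partial>distr M T Y) \<partial>M)"
    using P.integral_fst'[OF I] unfolding eq by (simp add: integral_distr)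
  also have "\<dots> = (\<integral>\<omega>. (\<integral>\<omega>'. f (Z \<omega>, Y \<omega>') \<partial>M) \<partial>M)"
    by (rule Bochner_Integration.integral_cong[OF refl inner])
  finally show "(\<integral>\<omega>. f (Z \<omega>, Y \<omega>) \<partial>M) = (\<integral>\<omega>. (\<integral>\<omega>'. f (Z \<omega>, Y \<omega>') \<partial>M) \<partial>M)" .
qed

lemma (in prob_space) expectation_power2_le:
  fixes X :: "'a \<Rightarrow> real"
  assumes "integrable M X" "integrable M (\<lambda>\<omega>. (X \<omega>)\<^sup>2)"
  shows "(expectation X)\<^sup>2 \<le> expectation (\<lambda>\<omega>. (X \<omega>)\<^sup>2)"
  using variance_eq[OF assms] variance_positive[of X] by simp

section \<open>The triangular law\<close>

definition triangular :: "real measure" where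
  "triangular = density lborel triangular_density"

lemma triangular_density_eq: "triangular_density = (\<lambda>s. ennreal (2 * s * indicator {0..1} s))"
  by (auto simp: triangular_density_def fun_eq_iff split: split_indicator)

lemma sets_triangular [measurable_cong, simp]: "sets triangular = sets borel"
  by (simp add: triangular_def)

lemma space_triangular [simp]: "space triangular = UNIV"
  by (simp add: triangular_def)

text \<open>The density vanishes at \<open>0\<close> and outside the unit interval, so the default
  value of division by zero never matters.\<close>

lemma AE_triangular: "AE u in triangular. 0 < u \<and> u \<le> 1"
  unfolding triangular_def
  by (subst AE_density) (auto simp: triangular_density_eq split: split_indicator)

lemma prob_space_triangular: "prob_space triangular"
proof
  have "emeasure triangular (space triangular) = (\<integral>\<^sup>+ s. ennreal (2 * s) * indicator {0..1} s \<partial>lborel)"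
    unfolding triangular_def
    by (subst emeasure_density) (auto simp: triangular_density_eq triangular_density_def[abs_def] intro!: nn_integral_cong split: split_indicator)
  also have "\<dots> = ennreal (1\<^sup>2 - 0\<^sup>2)"
    by (rule nn_integral_FTC_Icc) (auto intro!: derivative_eq_intros)
  finally show "emeasure triangular (space triangular) = 1" by simp
qed

lemma integral_triangular:
  fixes f :: "real \<Rightarrow> 'a::{banach, second_countable_topology}"
  assumes "f \<in> borel_measurable borel"
  shows "integral\<^sup>L triangular f = (\<integral>s. (2 * s * indicator {0..1} s) *\<^sub>R f s \<partial>lborel)"
  unfolding triangular_def triangular_density_eq
  using assms by (intro integral_density) (auto split: split_indicator)

context lipschitz_force
begin

section \<open>Expectation and fluctuation of one step\<close>

lemma pred_measurable [measurable (raw)]: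
  assumes f: "f \<in> borel_measurable M" and [measurable]: "g \<in> borel_measurable M"
  shows "(\<lambda>x. pred (f x) (g x)) \<in> borel_measurable M"
proof -
  have [measurable]: "f \<in> M \<rightarrow>\<^sub>M borel \<Otimes>\<^sub>M borel" using f by (simp add: borel_prod)
  show ?thesis unfolding pred_def by measurable
qed

lemma slope_measurable [measurable (raw)]:
  assumes f: "f \<in> borel_measurable M" and [measurable]: "g \<in> borel_measurable M"
  shows "(\<lambda>x. slope (f x) (g x)) \<in> borel_measurable M"
proof -
  have [measurable]: "f \<in> M \<rightarrow>\<^sub>M borel \<Otimes>\<^sub>M borel" using f by (simp add: borel_prod)
  note pred_measurable[OF f, measurable]
  show ?thesis unfolding slope_def by measurable
qed

lemma rrkn_step_measurable [measurable (raw)]: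
  assumes f: "f \<in> borel_measurable M" and [measurable]: "g \<in> borel_measurable M"
  shows "(\<lambda>x. rrkn_step F h (g x) (f x)) \<in> borel_measurable M"
proof -
  have [measurable]: "f \<in> M \<rightarrow>\<^sub>M borel \<Otimes>\<^sub>M borel" using f by (simp add: borel_prod)
  note slope_measurable[OF f, measurable]
  show ?thesis unfolding rrkn_step_eq base_def lift_def
    by (intro borel_measurable_add borel_measurable_Pair) measurable
qed

lemma AE_triangular_slope_le:
  "AE u in triangular. norm (slope z u) \<le> h / 2 * (norm (snd z) + norm (fst z) / 4)"
  using AE_triangular by eventually_elim (rule norm_slope_le; simp)

lemma integrable_slope: "integrable triangular (slope z)"
proof -
  interpret prob_space triangular by (rule prob_space_triangular)
  show ?thesis by (rule integrable_const_bound[OF AE_triangular_slope_le]) measurable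
qed

text \<open>The density \<open>2 u\<close> cancels the factor \<open>1 / (2 u)\<close> in the slope. Hence the mean step involves
  only an average of \<open>F\<close>, and its Lipschitz constant does not depend on \<open>\<Lambda>\<close>.\<close>

lemma integral_slope: "integral\<^sup>L triangular (slope z) = avg_F z - F (fst z)"
proof -
  let ?f = "\<lambda>u. F (pred z (u * h)) - F (fst z)"
  have si: "set_integrable lborel {0..1} ?f"
    by (intro borel_integrable_atLeastAtMost' continuous_intros)
  have "integral\<^sup>L triangular (slope z) = (\<integral>u. (2 * u * indicator {0..1} u) *\<^sub>R slope z u \<partial>lborel)"
    by (rule integral_triangular) measurable
  \<comment> \<open>At \<open>u = 0\<close> both sides vanish, the right one because
    \<open>pred z 0 = fst z\<close>.\<close>
  also have "(\<lambda>u. (2 * u * indicator {0..1} u) *\<^sub>R slope z u) = (\<lambda>u. indicator {0..1} u *\<^sub>R ?f u)"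
    by (auto simp: slope_def fun_eq_iff split: split_indicator)
  also have "(\<integral>u. indicator {0..1} u *\<^sub>R ?f u \<partial>lborel) = integral {0..1} ?f"
    using set_borel_integral_eq_integral(2)[OF si] by (simp add: set_lebesgue_integral_def)
  also have "\<dots> = avg_F z - F (fst z)"
    unfolding avg_F_def
    by (subst Henstock_Kurzweil_Integration.integral_diff)
      (auto intro: integrable_F_pred integrable_continuous_interval)
  finally show ?thesis .
qed

lemma integrable_rrkn_step: "integrable triangular (\<lambda>u. rrkn_step F h u z)"
proof -
  interpret prob_space triangular by (rule prob_space_triangular)
  show ?thesis unfolding rrkn_step_eq
    by (intro Bochner_Integration.integrable_add integrable_const integrable_bounded_linear[OF bounded_linear_lift] integrable_slope)
qed

lemma integral_rrkn_step: "(\<integral>u. rrkn_step F h u z \<partial>triangular) = mean_step z"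
proof -
  interpret prob_space triangular by (rule prob_space_triangular)
  show ?thesis unfolding rrkn_step_eq mean_step_def
    using integral_bounded_linear[OF bounded_linear_lift integrable_slope, of z] prob_space
      integrable_bounded_linear[OF bounded_linear_lift integrable_slope, of z]
    by (simp add: integral_slope)
qed

text \<open>The centre replaces the slope by its limit for \<open>u\<close> tending to
  \<open>0\<close>, which no longer depends on \<open>u\<close>. The Taylor error
  \<open>(u * h)\<^sup>2\<close> divided by \<open>2 * u\<close> leaves order
  \<open>h\<^sup>2\<close>, and \<open>lift\<close> contributes one more factor
  \<open>h\<close>.\<close>

lemma rrkn_step_deviation_le:
  assumes u: "0 < u" "u \<le> 1" and A: "norm z \<le> A"
  shows "norm (rrkn_step F h u z - (base z + lift ((h / 2) *\<^sub>R DF (fst z) (snd z))))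
    \<le> 7 / 12 * h ^ 3 * (\<Lambda> * (5 / 4 * A)\<^sup>2 + A / 2)"
proof -
  interpret lift: bounded_linear lift by (rule bounded_linear_lift)
  let ?K = "\<Lambda> * (5 / 4 * A)\<^sup>2 + A / 2" and ?w = "pred z (u * h) - fst z"
  have z: "norm (fst z) \<le> A" "norm (snd z) \<le> A"
    using A norm_fst_le[of "fst z" "snd z"] norm_snd_le[of "snd z" "fst z"] by auto
  have uh: "0 \<le> u * h" "u * h \<le> h" using u h_pos by (auto simp: mult_left_le_one_le)
  have "norm ?w \<le> u * h * (norm (snd z) + norm (fst z) / 4)"
    by (rule pred_diff_norm_le[OF uh])
  also have "\<dots> \<le> u * h * (5 / 4 * A)"
    using z uh by (intro mult_left_mono) auto
  finally have w: "norm ?w \<le> u * h * (5 / 4 * A)" .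
  have "norm (?w - (u * h) *\<^sub>R snd z) = (u * h)\<^sup>2 / 2 * norm (F (fst z))"
    by (simp add: pred_def)
  also have "\<dots> \<le> (u * h)\<^sup>2 / 2 * A"
    using z F_norm_le[of "fst z"] by (intro mult_left_mono) auto
  finally have w2: "norm (?w - (u * h) *\<^sub>R snd z) \<le> (u * h)\<^sup>2 * (A / 2)" by simp
  have "slope z u - (h / 2) *\<^sub>R DF (fst z) (snd z)
      = (1 / (2 * u)) *\<^sub>R (F (pred z (u * h)) - F (fst z) - (u * h) *\<^sub>R DF (fst z) (snd z))"
    using u by (simp add: slope_def scaleR_diff_right)
  also have "norm \<dots> = 1 / (2 * u) * norm (F (pred z (u * h)) - F (fst z) - (u * h) *\<^sub>R DF (fst z) (snd z))"
    using u by simp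
  also have "\<dots> \<le> 1 / (2 * u) * ((u * h)\<^sup>2 * ?K)"
    using F_taylor_curve[OF w w2, of "fst z"] u by (intro mult_left_mono) auto
  also have "\<dots> = u * (h\<^sup>2 / 2 * ?K)"
    using u by (simp add: power2_eq_square)
  also have "\<dots> \<le> h\<^sup>2 / 2 * ?K"
    using u \<Lambda>_nonneg order_trans[OF norm_ge_zero A] by (intro mult_left_le_one_le) auto
  finally have "norm (slope z u - (h / 2) *\<^sub>R DF (fst z) (snd z)) \<le> h\<^sup>2 / 2 * ?K" .
  then have "7 / 6 * h * norm (slope z u - (h / 2) *\<^sub>R DF (fst z) (snd z)) \<le> 7 / 6 * h * (h\<^sup>2 / 2 * ?K)"
    using h_pos by (intro mult_left_mono) auto
  then have "norm (lift (slope z u - (h / 2) *\<^sub>R DF (fst z) (snd z))) \<le> 7 / 6 * h * (h\<^sup>2 / 2 * ?K)"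
    by (rule order_trans[OF norm_lift_le])
  then show ?thesis
    by (simp add: rrkn_step_eq lift.diff power3_eq_cube power2_eq_square mult_ac)
qed

text \<open>Bias and variance of one step from a fixed state: the mean step carries the bias, and
  the variance is bounded through the centre of \<open>rrkn_step_deviation_le\<close>.\<close>

lemma integral_rrkn_step_diff_sq_le:
  assumes A: "norm z \<le> A"
  shows "(\<integral>u. (norm (rrkn_step F h u z - c))\<^sup>2 \<partial>triangular)
    \<le> (norm (mean_step z - c))\<^sup>2 + (7 / 12 * h ^ 3 * (\<Lambda> * (5 / 4 * A)\<^sup>2 + A / 2))\<^sup>2"
proof -
  interpret prob_space triangular by (rule prob_space_triangular)
  have "AE u in triangular. (norm (rrkn_step F h u z))\<^sup>2 \<le> ((1 + 2 * h) * norm z)\<^sup>2"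
    using AE_triangular by eventually_elim (simp add: norm_rrkn_step_le power_mono)
  then have "integrable triangular (\<lambda>u. (norm (rrkn_step F h u z))\<^sup>2)"
    by (intro integrable_const_bound[of _ "((1 + 2 * h) * norm z)\<^sup>2"]) auto
  moreover have "AE u in triangular. norm (rrkn_step F h u z - (base z + lift ((h / 2) *\<^sub>R DF (fst z) (snd z))))
    \<le> 7 / 12 * h ^ 3 * (\<Lambda> * (5 / 4 * A)\<^sup>2 + A / 2)"
    using AE_triangular by eventually_elim (rule rrkn_step_deviation_le; simp add: A)
  ultimately show ?thesis
    using integral_norm_diff_sq_le[OF integrable_rrkn_step, of z _ _ c] by (simp add: integral_rrkn_step)
qed

end

section \<open>Mean-square error\<close>

text \<open>Only nodes before \<open>k\<close> influence the state at index \<open>k\<close>; this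
  is what makes that state independent of node \<open>k\<close>.\<close>

lemma rrkn_chain_cong:
  "(\<And>i. i < k \<Longrightarrow> u i = u' i) \<Longrightarrow> rrkn_chain F h u z k = rrkn_chain F h u' z k"
  by (induction k) auto

text \<open>Discrete Gronwall argument in which deterministic errors add linearly and fluctuations
  add in squares. All earlier contributions are crudely amplified by the full power of
  \<open>G\<close>.\<close>

lemma mean_square_recursion_bound:
  fixes a :: "nat \<Rightarrow> real"
  assumes a: "\<And>k. 0 \<le> a k" "a 0 = 0"
    and step: "\<And>k. k < n \<Longrightarrow> (a (Suc k))\<^sup>2 \<le> (G * a k + \<beta>)\<^sup>2 + \<sigma>\<^sup>2"
    and G: "1 \<le> G" and \<beta>: "0 \<le> \<beta>" and \<sigma>: "0 \<le> \<sigma>"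
  shows "k \<le> n \<Longrightarrow> a k \<le> G ^ k * (real k * \<beta> + sqrt (real k) * \<sigma>)"
proof (induction k)
  case 0
  then show ?case using a by simp
next
  case (Suc k)
  let ?P = "G ^ Suc k" and ?s = "sqrt (real k)" and ?s' = "sqrt (real (Suc k))"
  have P: "1 \<le> ?P" using G by (rule one_le_power)
  have "\<beta> \<le> ?P * \<beta>" using P \<beta> mult_right_mono[of 1 ?P \<beta>] by simp
  moreover have "G * a k \<le> G * (G ^ k * (real k * \<beta> + ?s * \<sigma>))"
    using Suc G by (intro mult_left_mono) auto
  ultimately have "G * a k + \<beta> \<le> ?P * (real (Suc k) * \<beta> + ?s * \<sigma>)"
    by (simp add: algebra_simps)
  moreover have "\<sigma> \<le> ?P * \<sigma>" using P \<sigma> mult_right_mono[of 1 ?P \<sigma>] by simp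
  ultimately have "(G * a k + \<beta>)\<^sup>2 + \<sigma>\<^sup>2 \<le> (?P * (real (Suc k) * \<beta> + ?s * \<sigma>))\<^sup>2 + (?P * \<sigma>)\<^sup>2"
    using a(1)[of k] G \<beta> \<sigma> by (intro add_mono power_mono) auto
  also have "\<dots> = ?P\<^sup>2 * ((real (Suc k) * \<beta>)\<^sup>2 + 2 * (real (Suc k) * \<beta>) * (?s * \<sigma>) + (?s\<^sup>2 + 1) * \<sigma>\<^sup>2)"
    by algebra
  \<comment> \<open>Since \<open>?s\<^sup>2 + 1 = ?s'\<^sup>2\<close>, the new fluctuation fits
    exactly; only the cross term is enlarged, by \<open>?s\<close> \<le> \<open>?s'\<close>, to
    complete the square.\<close>
  also have "\<dots> \<le> ?P\<^sup>2 * ((real (Suc k) * \<beta>)\<^sup>2 + 2 * (real (Suc k) * \<beta>) * (?s' * \<sigma>) + ?s'\<^sup>2 * \<sigma>\<^sup>2)"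
    using \<beta> \<sigma> by (intro mult_left_mono add_mono mult_right_mono) auto
  also have "\<dots> = (?P * (real (Suc k) * \<beta> + ?s' * \<sigma>))\<^sup>2"
    by algebra
  finally have "(a (Suc k))\<^sup>2 \<le> (?P * (real (Suc k) * \<beta> + ?s' * \<sigma>))\<^sup>2"
    using step[of k] Suc.prems by simp
  then show ?case
    by (rule power2_le_imp_le) (use G \<beta> \<sigma> in auto)
qed

context lipschitz_force
begin

section \<open>Pathwise growth and measurability of the chain\<close>

lemma rrkn_chain_norm_le:
  "(\<And>i. 0 < u i \<and> u i \<le> 1) \<Longrightarrow> norm (rrkn_chain F h u z k) \<le> (1 + 2 * h) ^ k * norm z"
proof (induction k)
  case (Suc k)
  have "norm (rrkn_chain F h u z (Suc k)) \<le> (1 + 2 * h) * norm (rrkn_chain F h u z k)"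
    using Suc.prems by (simp add: norm_rrkn_step_le)
  also have "\<dots> \<le> (1 + 2 * h) * ((1 + 2 * h) ^ k * norm z)"
    using Suc h_pos by (intro mult_left_mono) auto
  finally show ?case by (simp add: mult_ac)
qed simp

text \<open>Compounded over total time \<open>1 / 2\<close>, the rate \<open>2\<close> of pathwise
  growth gives \<open>exp 1\<close>, and the Lipschitz rate \<open>5 / 2\<close> of the mean step
  gives \<open>exp (5 / 4)\<close>.\<close>

lemma power_le_exp:
  assumes c: "0 \<le> c" and k: "real k * h \<le> 1 / 2"
  shows "(1 + c * h) ^ k \<le> exp (c / 2)"
proof -
  have "(1 + c * h) ^ k \<le> exp (c * h) ^ k"
    using c h_pos by (intro power_mono exp_ge_add_one_self) auto
  also have "\<dots> = exp (c * (real k * h))"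
    by (simp add: mult_ac flip: exp_of_nat_mult)
  also have "\<dots> \<le> exp (c * (1 / 2))"
    using mult_left_mono[OF k c] by simp
  finally show ?thesis by simp
qed

lemma rrkn_chain_measurable_PiM:
  "{..<k} \<subseteq> I \<Longrightarrow> (\<lambda>u. rrkn_chain F h u z k) \<in> borel_measurable (PiM I (\<lambda>_. borel))"
proof (induction k)
  case (Suc k)
  then have "(\<lambda>u. rrkn_chain F h u z k) \<in> borel_measurable (PiM I (\<lambda>_. borel))"
    by (simp add: lessThan_Suc)
  moreover have "(\<lambda>u. u k) \<in> borel_measurable (PiM I (\<lambda>_. borel :: real measure))"
    using Suc.prems by (intro measurable_component_singleton) auto
  ultimately show ?case by (simp add: rrkn_step_measurable)
qed simp

end

locale lipschitz_force_triangular = lipschitz_force F DF \<Lambda> h + prob_space M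
  for F :: "real ^ 'd \<Rightarrow> real ^ 'd" and DF \<Lambda> h and M :: "'w measure" +
  fixes X :: "nat \<Rightarrow> 'w \<Rightarrow> real"
  assumes triangular: "iid_triangular M X"
begin

abbreviation chain where "chain z k \<omega> \<equiv> rrkn_chain F h (\<lambda>i. X i \<omega>) z k"

lemma X_measurable [measurable]: "X i \<in> borel_measurable M"
  using triangular by (auto simp: iid_triangular_def distributed_def)

lemma distr_X: "distr M borel (X i) = triangular"
proof -
  have "distr M borel (X i) = distr M lborel (X i)" by (rule distr_cong) auto
  then show ?thesis
    using triangular by (simp add: iid_triangular_def distributed_def triangular_def)
qed

lemma AE_X: "AE \<omega> in M. \<forall>i. 0 < X i \<omega> \<and> X i \<omega> \<le> 1"
proof -
  have "AE \<omega> in M. 0 < X i \<omega> \<and> X i \<omega> \<le> 1" for i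
    using AE_triangular unfolding distr_X[of i, symmetric] by (subst (asm) AE_distr_iff) auto
  then show ?thesis by (simp add: AE_all_countable)
qed

lemma chain_measurable [measurable]: "chain z k \<in> borel_measurable M"
  by (induction k) (simp_all add: rrkn_step_measurable)

lemma AE_chain_norm_le: "AE \<omega> in M. norm (chain z k \<omega>) \<le> (1 + 2 * h) ^ k * norm z"
  using AE_X by eventually_elim (rule rrkn_chain_norm_le; simp)

lemma AE_chain_dist_le: "AE \<omega> in M. norm (chain z k \<omega> - c) \<le> (1 + 2 * h) ^ k * norm z + norm c"
  using AE_chain_norm_le[of z k] by eventually_elim (meson norm_triangle_ineq4 add_right_mono order_trans)

lemma integrable_chain_dist: "integrable M (\<lambda>\<omega>. norm (chain z k \<omega> - c))"
  using AE_chain_dist_le[of z k c] by (intro integrable_const_bound[of _ "(1 + 2 * h) ^ k * norm z + norm c"]) auto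

lemma integrable_chain_dist_sq: "integrable M (\<lambda>\<omega>. (norm (chain z k \<omega> - c))\<^sup>2)"
proof (rule integrable_const_bound)
  show "AE \<omega> in M. norm ((norm (chain z k \<omega> - c))\<^sup>2) \<le> ((1 + 2 * h) ^ k * norm z + norm c)\<^sup>2"
    using AE_chain_dist_le[of z k c] by eventually_elim (simp add: power_mono)
qed measurable

text \<open>The tower property without conditional expectations: the state at index \<open>k\<close>
  depends on the first \<open>k\<close> nodes, and node \<open>k\<close> is independent of them with
  the triangular law.\<close>

lemma expectation_chain_Suc:
  "expectation (\<lambda>\<omega>. (norm (chain z (Suc k) \<omega> - c))\<^sup>2)
    = expectation (\<lambda>\<omega>. \<integral>u. (norm (rrkn_step F h u (chain z k \<omega>) - c))\<^sup>2 \<partial>triangular)"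
  and integrable_chain_Suc_integral:
  "integrable M (\<lambda>\<omega>. \<integral>u. (norm (rrkn_step F h u (chain z k \<omega>) - c))\<^sup>2 \<partial>triangular)"
proof -
  define S where "S = (\<lambda>I::nat set. PiM I (\<lambda>_. borel :: real measure))"
  define Z where "Z = (\<lambda>I \<omega>. restrict (\<lambda>i. X i \<omega>) I)"
  \<comment> \<open>The first argument holds the past nodes and the second the new one, as functions
    on the disjoint index sets \<open>{..<k}\<close> and \<open>{k}\<close>, so that independence of
    the two blocks applies.\<close>
  define f where "f = (\<lambda>(a, b :: nat \<Rightarrow> real). (norm (rrkn_step F h (b k) (rrkn_chain F h a z k) - c))\<^sup>2)"
  have ind: "indep_var (S {..<k}) (Z {..<k}) (S {k}) (Z {k})"
    unfolding S_def Z_def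
    by (rule indep_var_restrict[where I = UNIV]) (use triangular in \<open>auto simp: iid_triangular_def\<close>)
  have [measurable]: "f \<in> borel_measurable (S {..<k} \<Otimes>\<^sub>M S {k})"
  proof -
    have c: "(\<lambda>u. rrkn_chain F h u z k) \<in> borel_measurable (S {..<k})"
      unfolding S_def by (intro rrkn_chain_measurable_PiM) simp
    have k: "(\<lambda>u. u k) \<in> borel_measurable (S {k})"
      unfolding S_def by (intro measurable_component_singleton) simp
    have [measurable]: "(\<lambda>x. rrkn_step F h (snd x k) (rrkn_chain F h (fst x) z k)) \<in> borel_measurable (S {..<k} \<Otimes>\<^sub>M S {k})"
      by (intro rrkn_step_measurable measurable_compose[OF measurable_fst c] measurable_compose[OF measurable_snd k])
    show ?thesis unfolding f_def case_prod_beta by measurable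
  qed
  have chain_Z: "rrkn_chain F h (Z {..<k} \<omega>) z k = chain z k \<omega>" for \<omega>
    by (rule rrkn_chain_cong) (simp add: Z_def)
  have f: "f (Z {..<k} \<omega>, Z {k} \<omega>') = (norm (rrkn_step F h (X k \<omega>') (chain z k \<omega>) - c))\<^sup>2" for \<omega> \<omega>'
    by (simp add: f_def chain_Z) (simp add: Z_def)
  have int: "integrable M (\<lambda>\<omega>. f (Z {..<k} \<omega>, Z {k} \<omega>))"
    using integrable_chain_dist_sq[of z "Suc k" c] by (simp add: f)
  have inner: "(\<integral>\<omega>'. f (Z {..<k} \<omega>, Z {k} \<omega>') \<partial>M)
      = (\<integral>u. (norm (rrkn_step F h u (chain z k \<omega>) - c))\<^sup>2 \<partial>triangular)" for \<omega>
    unfolding f distr_X[of k, symmetric] by (subst integral_distr) auto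
  show "expectation (\<lambda>\<omega>. (norm (chain z (Suc k) \<omega> - c))\<^sup>2)
    = expectation (\<lambda>\<omega>. \<integral>u. (norm (rrkn_step F h u (chain z k \<omega>) - c))\<^sup>2 \<partial>triangular)"
    using integral_indep_var[OF ind _ int] unfolding inner by (simp add: f)
  show "integrable M (\<lambda>\<omega>. \<integral>u. (norm (rrkn_step F h u (chain z k \<omega>) - c))\<^sup>2 \<partial>triangular)"
    using integrable_indep_var_integral[OF ind _ int] unfolding inner by simp
qed

definition rms :: "(real ^ 'd) \<times> (real ^ 'd) \<Rightarrow> nat \<Rightarrow> (real ^ 'd) \<times> (real ^ 'd) \<Rightarrow> real" where
  "rms z k c = sqrt (expectation (\<lambda>\<omega>. (norm (chain z k \<omega> - c))\<^sup>2))"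

text \<open>For a fixed state the fluctuation is orthogonal to the bias, so
  \<open>\<sigma>\<^sup>2\<close> is merely added; the bias is the propagated old error plus the
  local error. Averaging over the state gives the recursion.\<close>

lemma rms_Suc_le:
  fixes z :: "(real ^ 'd) \<times> (real ^ 'd)"
  assumes k: "real k * h \<le> 1 / 2" and c': "norm (mean_step c - c') \<le> \<beta>"
  defines "A \<equiv> 3 * norm z"
  shows "(rms z (Suc k) c')\<^sup>2 \<le> ((1 + 5 / 2 * h) * rms z k c + \<beta>)\<^sup>2
    + (7 / 12 * h ^ 3 * (\<Lambda> * (5 / 4 * A)\<^sup>2 + A / 2))\<^sup>2" (is "_ \<le> (?G * _ + _)\<^sup>2 + ?\<sigma>\<^sup>2")
proof -
  define d where "d = (\<lambda>\<omega>. norm (chain z k \<omega> - c))"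
  have [measurable]: "d \<in> borel_measurable M" unfolding d_def by measurable
  have d: "integrable M d" "integrable M (\<lambda>\<omega>. (d \<omega>)\<^sup>2)"
    unfolding d_def by (rule integrable_chain_dist integrable_chain_dist_sq)+
  have \<beta>: "0 \<le> \<beta>" using c' norm_ge_zero order_trans by blast
  have G: "0 \<le> ?G" using h_pos by simp
  have A: "AE \<omega> in M. norm (chain z k \<omega>) \<le> A"
  proof -
    \<comment> \<open>The almost sure growth factor is at most \<open>exp 1\<close>, hence the
      radius \<open>3 * norm z\<close> in \<open>A\<close>.\<close>
    have "(1 + 2 * h) ^ k \<le> 3" using power_le_exp[of 2, OF _ k] exp_le by simp
    then have "(1 + 2 * h) ^ k * norm z \<le> A" by (simp add: A_def mult_right_mono)
    with AE_chain_norm_le[of z k] show ?thesis by (auto elim: order_trans)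
  qed
  have "expectation (\<lambda>\<omega>. (norm (chain z (Suc k) \<omega> - c'))\<^sup>2)
      = expectation (\<lambda>\<omega>. \<integral>u. (norm (rrkn_step F h u (chain z k \<omega>) - c'))\<^sup>2 \<partial>triangular)"
    by (rule expectation_chain_Suc)
  also have "\<dots> \<le> expectation (\<lambda>\<omega>. ?G\<^sup>2 * (d \<omega>)\<^sup>2 + 2 * ?G * \<beta> * d \<omega> + (\<beta>\<^sup>2 + ?\<sigma>\<^sup>2))"
  proof (rule integral_mono_AE)
    show "AE \<omega> in M. (\<integral>u. (norm (rrkn_step F h u (chain z k \<omega>) - c'))\<^sup>2 \<partial>triangular)
        \<le> ?G\<^sup>2 * (d \<omega>)\<^sup>2 + 2 * ?G * \<beta> * d \<omega> + (\<beta>\<^sup>2 + ?\<sigma>\<^sup>2)"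
      using A
    proof eventually_elim
      fix \<omega> assume "norm (chain z k \<omega>) \<le> A"
      then have "(\<integral>u. (norm (rrkn_step F h u (chain z k \<omega>) - c'))\<^sup>2 \<partial>triangular)
          \<le> (norm (mean_step (chain z k \<omega>) - c'))\<^sup>2 + ?\<sigma>\<^sup>2"
        by (rule integral_rrkn_step_diff_sq_le)
      moreover have "norm (mean_step (chain z k \<omega>) - c') \<le> ?G * d \<omega> + \<beta>"
        using norm_triangle_mono[OF mean_step_lipschitz[of "chain z k \<omega>" c] c'] by (simp add: d_def)
      then have "(norm (mean_step (chain z k \<omega>) - c'))\<^sup>2 \<le> (?G * d \<omega> + \<beta>)\<^sup>2"
        by (rule power_mono) simp
      moreover have "(?G * d \<omega> + \<beta>)\<^sup>2 + ?\<sigma>\<^sup>2 = ?G\<^sup>2 * (d \<omega>)\<^sup>2 + 2 * ?G * \<beta> * d \<omega> + (\<beta>\<^sup>2 + ?\<sigma>\<^sup>2)"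
        by algebra
      ultimately show "(\<integral>u. (norm (rrkn_step F h u (chain z k \<omega>) - c'))\<^sup>2 \<partial>triangular)
          \<le> ?G\<^sup>2 * (d \<omega>)\<^sup>2 + 2 * ?G * \<beta> * d \<omega> + (\<beta>\<^sup>2 + ?\<sigma>\<^sup>2)"
        by linarith
    qed
  qed (use d in \<open>auto intro!: integrable_chain_Suc_integral\<close>)
  also have "\<dots> = ?G\<^sup>2 * expectation (\<lambda>\<omega>. (d \<omega>)\<^sup>2) + 2 * ?G * \<beta> * expectation d + (\<beta>\<^sup>2 + ?\<sigma>\<^sup>2)"
    using d by (simp add: prob_space)
  also have "expectation (\<lambda>\<omega>. (d \<omega>)\<^sup>2) = (rms z k c)\<^sup>2"
    by (simp add: rms_def d_def)
  \<comment> \<open>The first moment in the cross term is bounded by the root of the second, after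
    which the square can be completed again.\<close>
  also have "expectation d \<le> rms z k c"
    using expectation_power2_le[OF d] unfolding rms_def d_def by (rule real_le_rsqrt)
  finally have "expectation (\<lambda>\<omega>. (norm (chain z (Suc k) \<omega> - c'))\<^sup>2)
      \<le> ?G\<^sup>2 * (rms z k c)\<^sup>2 + 2 * ?G * \<beta> * rms z k c + (\<beta>\<^sup>2 + ?\<sigma>\<^sup>2)"
    using G \<beta> by (simp add: mult_left_mono)
  moreover have "(rms z (Suc k) c')\<^sup>2 = expectation (\<lambda>\<omega>. (norm (chain z (Suc k) \<omega> - c'))\<^sup>2)"
    unfolding rms_def by (rule real_sqrt_pow2) simp
  ultimately have "(rms z (Suc k) c')\<^sup>2 \<le> ?G\<^sup>2 * (rms z k c)\<^sup>2 + 2 * ?G * \<beta> * rms z k c + (\<beta>\<^sup>2 + ?\<sigma>\<^sup>2)"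
    by simp
  also have "\<dots> = (?G * rms z k c + \<beta>)\<^sup>2 + ?\<sigma>\<^sup>2" by algebra
  finally show ?thesis .
qed

text \<open>There are at most \<open>1 / (2 * h)\<close> steps, so the local errors add up to order
  \<open>h ^ 3\<close>, while the fluctuations grow only with the square root of the number of steps
  and give the order \<open>5 / 2\<close>.\<close>

lemma rms_chain_le:
  fixes x v :: "real ^ 'd"
  assumes flow: "exact_flow_from F x v q p" and k: "real k * h \<le> 1 / 2"
  defines "N \<equiv> norm (x, v)"
  shows "rms (x, v) k (q (real k * h), p (real k * h))
    \<le> exp (5 / 4) * h powr (5 / 2) * (11 / 4 * N + 10 * \<Lambda> * N\<^sup>2)"
proof -
  define \<zeta> where "\<zeta> = (\<lambda>k. (q (real k * h), p (real k * h)))"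
  \<comment> \<open>The local error with \<open>B = 2 * N\<close>; the line below is the one-step
    deviation with \<open>A = 3 * N\<close>.\<close>
  define \<beta> where "\<beta> = h ^ 4 * (11 / 3 * N + 8 / 3 * \<Lambda> * N\<^sup>2)"
  define \<sigma> where "\<sigma> = 7 / 12 * h ^ 3 * (\<Lambda> * (5 / 4 * (3 * N))\<^sup>2 + 3 * N / 2)"
  have N: "0 \<le> N" by (simp add: N_def)
  have \<beta>0: "0 \<le> \<beta>" and \<sigma>0: "0 \<le> \<sigma>"
    using N \<Lambda>_nonneg h_pos by (simp_all add: \<beta>_def \<sigma>_def)
  have step: "(rms (x, v) (Suc j) (\<zeta> (Suc j)))\<^sup>2 \<le> ((1 + 5 / 2 * h) * rms (x, v) j (\<zeta> j) + \<beta>)\<^sup>2 + \<sigma>\<^sup>2"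
    if j: "j < k" for j
  proof -
    have "real (Suc j) * h \<le> real k * h" using j h_pos by (intro mult_right_mono) auto
    with k have Suc_j: "real j * h + h \<le> 1 / 2" by (simp add: algebra_simps)
    have "norm (q (real j * h + s), p (real j * h + s)) \<le> 2 * N" if s: "0 \<le> s" "s \<le> h" for s
    proof -
      have "norm (q (real j * h + s), p (real j * h + s)) \<le> exp (real j * h + s) * N"
        unfolding N_def using s h_pos by (intro exact_flow_norm_le[OF flow]) auto
      \<comment> \<open>The time is at most \<open>1 / 2\<close>, and the square of
        \<open>exp (1 / 2)\<close> is at most \<open>3\<close>.\<close>
      also have "\<dots> \<le> 2 * N"
      proof (rule mult_right_mono[OF _ N])
        have "(exp (real j * h + s))\<^sup>2 = exp (2 * (real j * h + s))" by (rule exp_double[symmetric])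
        also have "\<dots> \<le> exp 1" using s Suc_j by simp
        also have "\<dots> \<le> 2\<^sup>2" using exp_le by simp
        finally show "exp (real j * h + s) \<le> 2" by (rule power2_le_imp_le) simp
      qed
      finally show ?thesis .
    qed
    then have "norm (mean_step (q (real j * h), p (real j * h)) - (q (real j * h + h), p (real j * h + h)))
        \<le> h ^ 4 * (11 / 6 * (2 * N) + 2 / 3 * \<Lambda> * (2 * N)\<^sup>2)"
      using h_pos by (intro mean_step_local_error[OF flow]) auto
    moreover have "\<zeta> (Suc j) = (q (real j * h + h), p (real j * h + h))"
      by (simp add: \<zeta>_def algebra_simps)
    ultimately have "norm (mean_step (\<zeta> j) - \<zeta> (Suc j)) \<le> \<beta>"
      by (simp add: \<zeta>_def \<beta>_def mult.assoc)
    from rms_Suc_le[OF _ this, where z = "(x, v)"] Suc_j h_pos show ?thesis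
      by (simp add: \<sigma>_def N_def)
  qed
  have "rms (x, v) k (\<zeta> k) \<le> (1 + 5 / 2 * h) ^ k * (real k * \<beta> + sqrt (real k) * \<sigma>)"
  proof (rule mean_square_recursion_bound[where n = k])
    show "rms (x, v) 0 (\<zeta> 0) = 0"
      using flow by (simp add: rms_def \<zeta>_def exact_flow_from_def)
  qed (use step \<beta>0 \<sigma>0 h_pos in \<open>auto simp: rms_def\<close>)
  also have "\<dots> \<le> exp (5 / 4) * (h powr (5 / 2) * (11 / 4 * N + 10 * \<Lambda> * N\<^sup>2))"
  proof (rule mult_mono)
    show "(1 + 5 / 2 * h) ^ k \<le> exp (5 / 4)"
      using power_le_exp[OF _ k, of "5 / 2"] by simp
    have h3: "h ^ 3 = h powr (1 / 2) * h powr (5 / 2)"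
      using h_pos by (simp flip: powr_add powr_numeral)
    have "h ^ 3 \<le> h powr (5 / 2)"
      unfolding h3 using h_pos h_le by (intro mult_left_le_one_le) (auto intro: powr_le1)
    have "real k * \<beta> = (real k * h) * h ^ 3 * (11 / 3 * N + 8 / 3 * \<Lambda> * N\<^sup>2)"
      by (simp add: \<beta>_def eval_nat_numeral)
    also have "\<dots> \<le> 1 / 2 * h powr (5 / 2) * (11 / 3 * N + 8 / 3 * \<Lambda> * N\<^sup>2)"
      using k \<open>h ^ 3 \<le> h powr (5 / 2)\<close> N \<Lambda>_nonneg h_pos by (intro mult_right_mono mult_mono) auto
    finally have \<beta>_le: "real k * \<beta> \<le> h powr (5 / 2) * (11 / 6 * N + 4 / 3 * \<Lambda> * N\<^sup>2)"
      by (simp add: algebra_simps)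
    \<comment> \<open>Half a power of \<open>h\<close> pays for the square root of the number of
      steps, as \<open>real k * h\<close> stays bounded.\<close>
    have "sqrt (real k) * h ^ 3 = sqrt (real k * h) * h powr (5 / 2)"
      using h_pos unfolding h3 by (simp add: real_sqrt_mult powr_half_sqrt)
    also have "\<dots> \<le> h powr (5 / 2)"
      using k h_pos by (intro mult_left_le_one_le) auto
    finally have k3: "sqrt (real k) * h ^ 3 \<le> h powr (5 / 2)" .
    have "sqrt (real k) * \<sigma> = (sqrt (real k) * h ^ 3) * (7 / 8 * N + 525 / 64 * \<Lambda> * N\<^sup>2)"
      by (simp add: \<sigma>_def field_simps)
    also have "\<dots> \<le> h powr (5 / 2) * (7 / 8 * N + 525 / 64 * \<Lambda> * N\<^sup>2)"
      using k3 N \<Lambda>_nonneg by (intro mult_right_mono) auto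
    finally have "real k * \<beta> + sqrt (real k) * \<sigma>
        \<le> h powr (5 / 2) * ((11 / 6 * N + 4 / 3 * \<Lambda> * N\<^sup>2) + (7 / 8 * N + 525 / 64 * \<Lambda> * N\<^sup>2))"
      using \<beta>_le by (simp add: distrib_left)
    \<comment> \<open>Here \<open>11 / 6 + 7 / 8 = 65 / 24\<close> is below \<open>11 / 4\<close>,
      and \<open>4 / 3 + 525 / 64\<close> is below \<open>10\<close>.\<close>
    also have "\<dots> \<le> h powr (5 / 2) * (11 / 4 * N + 10 * \<Lambda> * N\<^sup>2)"
    proof (rule mult_left_mono)
      have "0 \<le> \<Lambda> * N\<^sup>2" using \<Lambda>_nonneg by simp
      then show "(11 / 6 * N + 4 / 3 * \<Lambda> * N\<^sup>2) + (7 / 8 * N + 525 / 64 * \<Lambda> * N\<^sup>2) \<le> 11 / 4 * N + 10 * \<Lambda> * N\<^sup>2"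
        using N by simp
    qed simp
    finally show "real k * \<beta> + sqrt (real k) * \<sigma> \<le> h powr (5 / 2) * (11 / 4 * N + 10 * \<Lambda> * N\<^sup>2)" .
  qed (use \<beta>0 \<sigma>0 in auto)
  finally show ?thesis by (simp add: \<zeta>_def mult_ac)
qed

end

section \<open>Rescaling to unit Lipschitz constant\<close>

lemma gradient_eq_0_at_minimum:
  assumes "f differentiable (at x)" and "\<And>y. f x \<le> f y"
  shows "gradient f x = 0"
proof (rule gradient_eqI)
  obtain f' where f': "(f has_derivative f') (at x)"
    using assms(1) by (auto simp: differentiable_def)
  then have "f' = (\<lambda>_. 0)"
    using assms(2) by (intro differential_zero_maxmin[of x UNIV]) auto
  then show "GDERIV f x :> 0" using f' by (simp add: gderiv_def)
qed

lemma norm_matrix_vector_mult_le_op_norm: "norm (A *v w) \<le> op_norm A * norm w"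
  unfolding op_norm_def by (rule onorm) (rule matrix_vector_mul_bounded_linear)

text \<open>The time unit becomes \<open>1 / sqrt L\<close>: velocities are divided by
  \<open>sqrt L\<close>, accelerations by \<open>L\<close>, and step sizes are multiplied by
  \<open>sqrt L\<close>. In these units the weighted norm is Euclidean.\<close>

definition rescale :: "real \<Rightarrow> 'a \<times> 'b::real_vector \<Rightarrow> 'a \<times> 'b" where
  "rescale L z = (fst z, snd z /\<^sub>R sqrt L)"

lemma wnorm_eq_norm_rescale: "L > 0 \<Longrightarrow> wnorm L z = norm (rescale L z)"
  by (simp add: wnorm_def rescale_def norm_prod_def power_mult_distrib power_inverse divide_inverse mult.commute)

lemma rescale_diff: "rescale L (y - z) = rescale L y - rescale L (z :: (real ^ 'd) \<times> (real ^ 'd))"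
  by (simp add: rescale_def scaleR_diff_right)

text \<open>Every term of the scheme is dimensionally homogeneous and the node \<open>u\<close> is
  dimensionless, so the scheme commutes with the change of units.\<close>

lemma rrkn_step_rescale:
  assumes L: "L > 0"
  shows "rrkn_step (\<lambda>y. F y /\<^sub>R L) (sqrt L * h) u (rescale L z) = rescale L (rrkn_step F h u z)"
proof -
  have L': "(sqrt L * c)\<^sup>2 = c\<^sup>2 * L" "L \<noteq> 0" for c using L by (auto simp: power_mult_distrib)
  have c1: "(a * sqrt L) *\<^sub>R (w /\<^sub>R sqrt L) = a *\<^sub>R w" for a and w :: "real ^ 'd"
    using L by simp
  have c2: "(a * L) *\<^sub>R (w /\<^sub>R L) = a *\<^sub>R w" for a and w :: "real ^ 'd"
    using L by simp
  have c3: "(a * sqrt L) *\<^sub>R (w /\<^sub>R L) = (a *\<^sub>R w) /\<^sub>R sqrt L" for a and w :: "real ^ 'd"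
    using L sqrt_divide_self_eq[of L] by (simp add: divide_inverse mult.assoc mult.commute)
  \<comment> \<open>The powers of \<open>sqrt L\<close> are split off each coefficient, ready to
    cancel against the rescaled velocities and forces by \<open>c1\<close>, \<open>c2\<close> and
    \<open>c3\<close>.\<close>
  have coeffs: "u * (sqrt L * h) = (u * h) * sqrt L" "sqrt L * h = h * sqrt L"
    "(u * (sqrt L * h))\<^sup>2 / 2 = ((u * h)\<^sup>2 / 2) * L" "(sqrt L * h)\<^sup>2 / 2 = (h\<^sup>2 / 2) * L"
    "(sqrt L * h)\<^sup>2 / (6 * u) = (h\<^sup>2 / (6 * u)) * L" "sqrt L * h / (2 * u) = (h / (2 * u)) * sqrt L"
    using L'(1)[of "u * h"] L'(1)[of h] by (simp_all add: mult_ac)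
  have diff: "w /\<^sub>R L - w' /\<^sub>R L = (w - w') /\<^sub>R L" for w w' :: "real ^ 'd"
    by (simp add: scaleR_diff_right)
  show ?thesis
    unfolding rescale_def rrkn_step_def case_prod_beta Let_def fst_conv snd_conv diff coeffs(3-6)
    unfolding coeffs(1)
    unfolding coeffs(2) c1 c2 c3
    by (simp add: scaleR_add_right)
qed

lemma rrkn_chain_rescale:
  "L > 0 \<Longrightarrow> rrkn_chain (\<lambda>y. F y /\<^sub>R L) (sqrt L * h) u (rescale L z) k = rescale L (rrkn_chain F h u z k)"
  by (induction k) (simp_all add: rrkn_step_rescale)

lemma exact_flow_rescale:
  assumes L: "L > 0" and flow: "exact_flow_from F x v q p"
  shows "exact_flow_from (\<lambda>y. F y /\<^sub>R L) x (v /\<^sub>R sqrt L) (\<lambda>t. q (t / sqrt L)) (\<lambda>t. p (t / sqrt L) /\<^sub>R sqrt L)"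
proof -
  have L': "inverse (sqrt L) * inverse (sqrt L) = inverse L"
    using L by (simp flip: inverse_mult_distrib)
  have q: "((\<lambda>t. q (t / sqrt L)) has_vector_derivative p (t / sqrt L) /\<^sub>R sqrt L) (at t within {0..})"
    and p: "((\<lambda>t. p (t / sqrt L)) has_vector_derivative F (q (t / sqrt L)) /\<^sub>R sqrt L) (at t within {0..})"
    if "t \<ge> 0" for t
  proof -
    have aff: "((\<lambda>t. t / sqrt L) has_vector_derivative inverse (sqrt L)) (at t within {0..})"
      by (auto intro!: derivative_eq_intros simp: divide_inverse has_real_derivative_iff_has_vector_derivative[symmetric])
    have sub: "(\<lambda>t. t / sqrt L) ` {0..} \<subseteq> {0..}" using L by auto
    have "(q has_vector_derivative p (t / sqrt L)) (at (t / sqrt L) within (\<lambda>t. t / sqrt L) ` {0..})"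
      "(p has_vector_derivative F (q (t / sqrt L))) (at (t / sqrt L) within (\<lambda>t. t / sqrt L) ` {0..})"
      using flow that L sub by (auto simp: exact_flow_from_def intro: has_vector_derivative_within_subset)
    from this[THEN vector_diff_chain_within[OF aff]]
    show "((\<lambda>t. q (t / sqrt L)) has_vector_derivative p (t / sqrt L) /\<^sub>R sqrt L) (at t within {0..})"
      and "((\<lambda>t. p (t / sqrt L)) has_vector_derivative F (q (t / sqrt L)) /\<^sub>R sqrt L) (at t within {0..})"
      by (simp_all add: o_def)
  qed
  have "((\<lambda>t. p (t / sqrt L) /\<^sub>R sqrt L) has_vector_derivative F (q (t / sqrt L)) /\<^sub>R L) (at t within {0..})"
    if "t \<ge> 0" for t
    using bounded_linear.has_vector_derivative[OF bounded_linear_scaleR_right[of "inverse (sqrt L)"] p[OF that]]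
    by (simp add: L')
  then show ?thesis
    using flow q by (simp add: exact_flow_from_def)
qed

text \<open>The minimum at \<open>0\<close> makes the force vanish there. Division by
  \<open>L\<close> normalizes the Lipschitz constant of the force and turns \<open>L_H\<close> into
  \<open>L_H / L\<close>.\<close>

lemma lipschitz_force_rescale:
  assumes C2: "twice_cont_diff U"
    and min: "\<And>y. U 0 \<le> U y"
    and L: "L > 0" "\<And>y z. norm (gradient U y - gradient U z) \<le> L * norm (y - z)"
    and L_H: "L_H \<ge> 0" "\<And>y z. op_norm (hessian U y - hessian U z) \<le> L_H * norm (y - z)"
    and h: "h > 0" "h \<le> 1 / 2"
  shows "lipschitz_force (\<lambda>y. force U y /\<^sub>R L) (\<lambda>y w. (- (hessian U y *v w)) /\<^sub>R L) (L_H / L) h"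
proof
  show "force U 0 /\<^sub>R L = 0"
    using C2 min by (simp add: force_def twice_cont_diff_def gradient_eq_0_at_minimum)
  show "norm (force U y /\<^sub>R L - force U z /\<^sub>R L) \<le> norm (y - z)" for y z
  proof -
    have "force U y /\<^sub>R L - force U z /\<^sub>R L = (gradient U z - gradient U y) /\<^sub>R L"
      by (simp add: force_def scaleR_diff_right)
    then show ?thesis
      using L(1) L(2)[of z y] by (simp add: divide_inverse[symmetric] mult.commute[of "inverse L"] pos_divide_le_eq norm_minus_commute[of z y] mult.commute[of L])
  qed
  show "((\<lambda>y. force U y /\<^sub>R L) has_derivative (\<lambda>w. (- (hessian U y *v w)) /\<^sub>R L)) (at y)" for y
  proof -
    have "(gradient U has_derivative (\<lambda>w. hessian U y *v w)) (at y)"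
      using C2 unfolding hessian_def by (simp add: twice_cont_diff_def jacobian_works[symmetric])
    then show ?thesis
      unfolding force_def by (intro has_derivative_scaleR_right has_derivative_minus)
  qed
  show "norm ((- (hessian U y *v w)) /\<^sub>R L - (- (hessian U z *v w)) /\<^sub>R L) \<le> L_H / L * norm (y - z) * norm w" for y z w
  proof -
    have "norm (- (hessian U y *v w) - - (hessian U z *v w)) = norm ((hessian U y - hessian U z) *v w)"
      by (simp add: matrix_vector_mult_diff_rdistrib norm_minus_commute)
    also have "\<dots> \<le> op_norm (hessian U y - hessian U z) * norm w"
      by (rule norm_matrix_vector_mult_le_op_norm)
    also have "\<dots> \<le> L_H * norm (y - z) * norm w"
      by (intro mult_right_mono L_H) auto
    finally show ?thesis
      using L(1) by (simp add: divide_inverse mult.commute mult.left_commute flip: scaleR_diff_right)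
  qed
qed (use L L_H h in auto)

text \<open>Isolates the factor \<open>L\<close> that cancels the denominator of
  \<open>L_H / L\<close> when the second term of the bound is brought to rescaled form.\<close>

lemma powr_five_halves:
  fixes L h :: real
  assumes L: "L > 0" and h: "h > 0"
  shows "(sqrt L * h) powr (5 / 2) = (sqrt L * L / L powr (1 / 4)) * (h ^ 3 / sqrt h)"
proof -
  have "sqrt L * L = L powr (1 / 2) * L powr 1" using L by (simp add: powr_half_sqrt)
  also have "\<dots> = L powr (3 / 2)" unfolding powr_add[symmetric] by simp
  finally have "sqrt L * L / L powr (1 / 4) = L powr (5 / 4)" by (simp add: powr_diff[symmetric])
  moreover have "h ^ 3 / sqrt h = h powr 3 / h powr (1 / 2)" using h by (simp add: powr_half_sqrt)
  then have "h ^ 3 / sqrt h = h powr (5 / 2)" unfolding powr_diff[symmetric] by simp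
  ultimately show ?thesis
    using L h by (simp add: powr_mult powr_powr powr_half_sqrt[symmetric])
qed

section \<open>The error bound in the original units\<close>

theorem theorem1:
  fixes U :: "real ^ 'd \<Rightarrow> real"
    and L L_H T h :: real
    and M :: "'w measure"
    and \<U> :: "nat \<Rightarrow> 'w \<Rightarrow> real"
    and x v :: "real ^ 'd"
    and q p :: "real \<Rightarrow> real ^ 'd"
  assumes C2: "twice_cont_diff U"
    and A1: "\<And>y. U 0 \<le> U y" "U 0 = 0"
    and A2: "L > 0" "\<And>y z. norm (gradient U y - gradient U z) \<le> L * norm (y - z)"
    and A3: "L_H \<ge> 0" "\<And>y z. op_norm (hessian U y - hessian U z) \<le> L_H * norm (y - z)"
    and T: "T > 0" "L * T\<^sup>2 \<le> 1 / 4"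
    and h: "h > 0" "T / h \<in> \<int>"
    and prob: "prob_space M"
    and rv: "iid_triangular M \<U>"
    and flow: "exact_flow_from (force U) x v q p"
  shows "(\<forall>k. real k * h \<le> T \<longrightarrow>
      integrable M (\<lambda>\<omega>. (wnorm L (rrkn_chain (force U) h (\<lambda>i. \<U> i \<omega>) (x, v) k
                               - (q (real k * h), p (real k * h))))\<^sup>2)) \<and>
    (MAX k\<in>{k::nat. real k * h \<le> T}.
       sqrt (\<integral>\<omega>. (wnorm L (rrkn_chain (force U) h (\<lambda>i. \<U> i \<omega>) (x, v) k
                       - (q (real k * h), p (real k * h))))\<^sup>2 \<partial>M))
      \<le> 11 / 10 * exp (5 / 2) * wnorm L (x, v) * (sqrt L * h) powr (5 / 2)
        + 9 * exp (5 / 2) * (wnorm L (x, v))\<^sup>2 * sqrt L * (L_H * h ^ 3 / (L powr (1 / 4) * sqrt h))"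
    (is "_ \<and> (MAX k\<in>?K. ?e k) \<le> ?bound")
proof -
  let ?\<eta> = "sqrt L * h" and ?\<Lambda> = "L_H / L" and ?N = "wnorm L (x, v)"
  have T': "sqrt L * T \<le> 1 / 2"
  proof (rule power2_le_imp_le)
    show "(sqrt L * T)\<^sup>2 \<le> (1 / 2)\<^sup>2"
      using T(2) A2(1) by (simp add: power_mult_distrib power_divide)
  qed simp
  \<comment> \<open>Integrality of \<open>T / h\<close> enters here: a positive integer is at least
    one, so the rescaled step inherits the bound \<open>1 / 2\<close> from the rescaled
    time.\<close>
  have "h \<le> T"
  proof -
    obtain n :: int where n: "T / h = of_int n" using h(2) by (auto elim: Ints_cases)
    moreover have "0 < T / h" using T h by simp
    ultimately have "1 \<le> n" by simp
    then have "1 \<le> T / h" by (simp add: n)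
    then show ?thesis using h(1) by (simp add: field_simps)
  qed
  then have "?\<eta> \<le> sqrt L * T" using A2(1) by simp
  then have \<eta>: "0 < ?\<eta>" "?\<eta> \<le> 1 / 2"
    using T' A2(1) h(1) by (simp, linarith)
  interpret lipschitz_force "\<lambda>y. force U y /\<^sub>R L" "\<lambda>y w. (- (hessian U y *v w)) /\<^sub>R L" ?\<Lambda> ?\<eta>
    using lipschitz_force_rescale[OF C2 A1(1) A2 A3 \<eta>] .
  interpret prob_space M by (rule prob)
  interpret lipschitz_force_triangular "\<lambda>y. force U y /\<^sub>R L" "\<lambda>y w. (- (hessian U y *v w)) /\<^sub>R L" ?\<Lambda> ?\<eta> M \<U>
    by unfold_locales (rule rv)
  let ?z = "rescale L (x, v)"
  have z: "?z = (x, v /\<^sub>R sqrt L)" by (simp add: rescale_def)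
  have error: "wnorm L (rrkn_chain (force U) h (\<lambda>i. \<U> i \<omega>) (x, v) k - (q (real k * h), p (real k * h)))
      = norm (chain ?z k \<omega> - rescale L (q (real k * h), p (real k * h)))" for k \<omega>
    by (simp add: wnorm_eq_norm_rescale A2(1) rescale_diff rrkn_chain_rescale)
  have "?N\<^sup>2 * sqrt L * (L_H * h ^ 3 / (L powr (1 / 4) * sqrt h)) = ?\<Lambda> * ?N\<^sup>2 * ?\<eta> powr (5 / 2)"
    using A2(1) h(1) by (simp add: powr_five_halves)
  then have bound_eq: "?bound = exp (5 / 2) * ?\<eta> powr (5 / 2) * (11 / 10 * ?N + 9 * ?\<Lambda> * ?N\<^sup>2)"
  proof -
    assume eq: "?N\<^sup>2 * sqrt L * (L_H * h ^ 3 / (L powr (1 / 4) * sqrt h)) = ?\<Lambda> * ?N\<^sup>2 * ?\<eta> powr (5 / 2)"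
    have "9 * exp (5 / 2) * ?N\<^sup>2 * sqrt L * (L_H * h ^ 3 / (L powr (1 / 4) * sqrt h))
        = 9 * exp (5 / 2) * (?N\<^sup>2 * sqrt L * (L_H * h ^ 3 / (L powr (1 / 4) * sqrt h)))"
      by (simp only: mult_ac)
    then show ?thesis unfolding eq by (simp add: distrib_left mult_ac)
  qed
  have "?e k \<le> ?bound" if k: "real k * h \<le> T" for k
  proof -
    have "real k * ?\<eta> = sqrt L * (real k * h)" by simp
    also have "\<dots> \<le> sqrt L * T" using k A2(1) by (intro mult_left_mono) auto
    finally have k': "real k * ?\<eta> \<le> 1 / 2" using T' by linarith
    \<comment> \<open>Half of the exponent in \<open>exp (5 / 2)\<close> comes from the error
      recursion. The other half absorbs constants: \<open>11 / 4 = 5 / 2 * (11 / 10)\<close>, and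
      \<open>10\<close> is below \<open>5 / 2 * 9\<close>.\<close>
    have "(5 / 2 :: real) \<le> (1 + 5 / 8)\<^sup>2" by (simp add: power2_eq_square)
    also have "\<dots> \<le> (exp (5 / 8))\<^sup>2" by (intro power_mono exp_ge_add_one_self) simp
    also have "\<dots> = exp (5 / 4)" by (simp flip: exp_double)
    finally have e: "5 / 2 \<le> exp (5 / 4 :: real)" .
    have N: "0 \<le> ?N" using A2(1) by (simp add: wnorm_def)
    have "11 / 4 * ?N + 10 * ?\<Lambda> * ?N\<^sup>2 \<le> 5 / 2 * (11 / 10 * ?N + 9 * ?\<Lambda> * ?N\<^sup>2)"
    proof -
      have "0 \<le> ?\<Lambda> * ?N\<^sup>2" using A2(1) A3(1) by simp
      then show ?thesis unfolding mult.assoc distrib_left using N by linarith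
    qed
    also have "\<dots> \<le> exp (5 / 4) * (11 / 10 * ?N + 9 * ?\<Lambda> * ?N\<^sup>2)"
      using N A2(1) A3(1) by (intro mult_right_mono e) auto
    finally have const: "11 / 4 * ?N + 10 * ?\<Lambda> * ?N\<^sup>2 \<le> exp (5 / 4) * (11 / 10 * ?N + 9 * ?\<Lambda> * ?N\<^sup>2)" .
    have "?e k = rms ?z k (rescale L (q (real k * h), p (real k * h)))"
      by (simp add: rms_def error)
    \<comment> \<open>The rescaled exact flow at rescaled time \<open>real k * ?\<eta>\<close> is
      the original flow at time \<open>real k * h\<close>.\<close>
    also have "rescale L (q (real k * h), p (real k * h))
        = (q (real k * ?\<eta> / sqrt L), p (real k * ?\<eta> / sqrt L) /\<^sub>R sqrt L)"
      using A2(1) by (simp add: rescale_def)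
    also have "rms ?z k \<dots> \<le> exp (5 / 4) * ?\<eta> powr (5 / 2) * (11 / 4 * ?N + 10 * ?\<Lambda> * ?N\<^sup>2)"
      using rms_chain_le[OF exact_flow_rescale[OF A2(1) flow] k']
      by (simp add: wnorm_eq_norm_rescale A2(1) flip: z)
    also have "\<dots> \<le> exp (5 / 4) * ?\<eta> powr (5 / 2) * (exp (5 / 4) * (11 / 10 * ?N + 9 * ?\<Lambda> * ?N\<^sup>2))"
      by (intro mult_left_mono const) simp
    also have "\<dots> = (exp (5 / 4) * exp (5 / 4)) * ?\<eta> powr (5 / 2) * (11 / 10 * ?N + 9 * ?\<Lambda> * ?N\<^sup>2)"
      by (simp only: mult_ac)
    also have "\<dots> = ?bound"
      unfolding bound_eq by (simp flip: exp_add)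
    finally show ?thesis .
  qed
  \<comment> \<open>Together with nonemptiness, witnessed by \<open>k = 0\<close>, this makes the
    maximum a genuine one.\<close>
  moreover have "finite ?K"
  proof (rule finite_subset)
    show "?K \<subseteq> {..nat \<lfloor>T / h\<rfloor>}" using h(1) by (auto simp: le_nat_floor field_simps)
  qed simp
  moreover have "?K \<noteq> {}" using T by (auto intro: exI[of _ 0])
  ultimately have "(MAX k\<in>?K. ?e k) \<le> ?bound"
    by (intro Max.boundedI) auto
  then show ?thesis
    unfolding error using integrable_chain_dist_sq by blast
qed

end
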